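(* Let $k$ be a field with $\mathrm{char}(k)\neq 2$ and let $q,t\in k$ be nonzero scalars such that $t^{1/2}$ exists in $k$. Then the double affine Hecke algebra $\mathbb{H}_{q,t}(GL_2(k))$ is a noetherian ring.
   Context: Noetherian means left and right noetherian. Fixing a square root $t^{1/2}\in k$ of $t$, the double affine Hecke algebra $\mathbb{H}_{q,t}(GL_2(k))$ is the associative unital $k$-algebra generated by invertible elements $T,X_1,X_2,Y_1,Y_2$ with defining relations: $X_1X_2=X_2X_1$, $Y_1Y_2=Y_2Y_1$, $(T-t^{1/2})(T+t^{-1/2})=0$, $Y_2^{-1}X_1Y_2X_1^{-1}=T^2$, $T^{-1}Y_1T^{-1}=Y_2$, $TX_1T=X_2$, $Y_1Y_2X_1=qX_1Y_1Y_2$, $Y_1Y_2X_2=qX_2Y_1Y_2$, $X_1X_2Y_1=q^{-1}Y_1X_1X_2$, $X_1X_2Y_2=q^{-1}Y_2X_1X_2$. *)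

theory Defs
  imports
    "HOL-Library.Poly_Mapping"
    "HOL-Algebra.Ring_Divisibility"
    "HOL-Algebra.QuotRing"
    "HOL-Algebra.Algebraic_Closure_Type"
begin

section \<open>Left and right noetherian rings\<close>

text \<open>
  The locale \<^locale>\<open>noetherian_ring\<close> of HOL-Algebra speaks about two-sided ideals only, so the
  one-sided versions needed for noncommutative rings are introduced here, in the same style.
\<close>

locale left_ideal = additive_subgroup I R + ring R for I and R (structure) +
  assumes l_closed: "\<lbrakk>a \<in> I; x \<in> carrier R\<rbrakk> \<Longrightarrow> x \<otimes> a \<in> I"

locale right_ideal = additive_subgroup I R + ring R for I and R (structure) +
  assumes r_closed: "\<lbrakk>a \<in> I; x \<in> carrier R\<rbrakk> \<Longrightarrow> a \<otimes> x \<in> I"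

definition gen_left_ideal :: "('a, 'b) ring_scheme \<Rightarrow> 'a set \<Rightarrow> 'a set"
  where "gen_left_ideal R S = \<Inter>{I. left_ideal I R \<and> S \<subseteq> I}"

definition gen_right_ideal :: "('a, 'b) ring_scheme \<Rightarrow> 'a set \<Rightarrow> 'a set"
  where "gen_right_ideal R S = \<Inter>{I. right_ideal I R \<and> S \<subseteq> I}"

locale left_noetherian_ring = ring +
  assumes left_finitely_gen:
    "left_ideal I R \<Longrightarrow> \<exists>A \<subseteq> carrier R. finite A \<and> I = gen_left_ideal R A"

locale right_noetherian_ring = ring +
  assumes right_finitely_gen:
    "right_ideal I R \<Longrightarrow> \<exists>A \<subseteq> carrier R. finite A \<and> I = gen_right_ideal R A"

locale left_right_noetherian_ring = left_noetherian_ring + right_noetherian_ring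


section \<open>Free associative algebras\<close>

text \<open>
  The free monoid on \<open>'a\<close>, written additively because the convolution product of
  \<^theory>\<open>HOL-Library.Poly_Mapping\<close> multiplies \<open>single u a * single v b = single (u + v) (a * b)\<close>.
  Here \<open>+\<close> is concatenation of words and is not commutative.
\<close>

datatype 'a free_monoid = Word (letters: "'a list")

instantiation free_monoid :: (type) monoid_add
begin

definition zero_free_monoid :: "'a free_monoid"
  where "0 = Word []"

definition plus_free_monoid :: "'a free_monoid \<Rightarrow> 'a free_monoid \<Rightarrow> 'a free_monoid"
  where "u + v = Word (letters u @ letters v)"

instance
  by standard (simp_all add: zero_free_monoid_def plus_free_monoid_def)

end

text \<open>
  The free unital associative \<open>'k\<close>-algebra on \<open>'g\<close>: finite \<open>'k\<close>-linear combinations of words.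
\<close>

type_synonym ('g, 'k) free_algebra = "'g free_monoid \<Rightarrow>\<^sub>0 'k"

definition scalar :: "'k \<Rightarrow> ('g, 'k::ring_1) free_algebra"
  where "scalar c = Poly_Mapping.single 0 c"

definition letter :: "'g \<Rightarrow> ('g, 'k::ring_1) free_algebra"
  where "letter g = Poly_Mapping.single (Word [g]) 1"


section \<open>The double affine Hecke algebra of type \<open>GL\<^sub>2\<close>\<close>

datatype daha_generator = Gen_T | Gen_X1 | Gen_X2 | Gen_Y1 | Gen_Y2

text \<open>
  Invertibility of the generators is imposed by adjoining formal inverses \<open>Neg g\<close> as further
  letters, together with the relations making them two-sided inverses.
\<close>

datatype daha_letter = Pos daha_generator | Neg daha_generator

text \<open>
  The parameter \<open>s\<close> is the chosen square root \<open>t\<^sup>1\<^sup>/\<^sup>2\<close>; the parameter \<open>t\<close> enters the relations only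
  through it. Each relation \<open>l = r\<close> is recorded as the element \<open>l - r\<close>.
\<close>

definition daha_relations :: "'k::field \<Rightarrow> 'k \<Rightarrow> (daha_letter, 'k) free_algebra set"
  where "daha_relations q s =
    (let T = letter (Pos Gen_T);   T' = letter (Neg Gen_T);
         X1 = letter (Pos Gen_X1); X1' = letter (Neg Gen_X1);
         X2 = letter (Pos Gen_X2);
         Y1 = letter (Pos Gen_Y1);
         Y2 = letter (Pos Gen_Y2); Y2' = letter (Neg Gen_Y2)
     in (\<Union>g. {letter (Pos g) * letter (Neg g) - 1, letter (Neg g) * letter (Pos g) - 1}) \<union>
        {X1 * X2 - X2 * X1,
         Y1 * Y2 - Y2 * Y1,
         (T - scalar s) * (T + scalar (inverse s)),
         Y2' * X1 * Y2 * X1' - T^2,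
         T' * Y1 * T' - Y2,
         T * X1 * T - X2,
         Y1 * Y2 * X1 - scalar q * X1 * Y1 * Y2,
         Y1 * Y2 * X2 - scalar q * X2 * Y1 * Y2,
         X1 * X2 * Y1 - scalar (inverse q) * Y1 * X1 * X2,
         X1 * X2 * Y2 - scalar (inverse q) * Y2 * X1 * X2})"

definition daha_GL2 :: "'k::field \<Rightarrow> 'k \<Rightarrow> (daha_letter, 'k) free_algebra set ring"
  where "daha_GL2 q s =
    ring_of_type_algebra Quot genideal ring_of_type_algebra (daha_relations q s)"

lemma ring_of_type_algebra_is_ring: "ring (ring_of_type_algebra :: 'a::ring_1 ring)"
proof -
  have "\<exists>y. x + y = 0" "\<exists>y. y + x = 0" for x :: 'a
    by (rule exI[of _ "- x"], simp)+
  then show ?thesis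
    unfolding ring_of_type_algebra_def
    by unfold_locales (auto simp: algebra_simps Units_def)
qed

lemma daha_GL2_is_ring: "ring (daha_GL2 q s)"
proof -
  interpret F: ring "ring_of_type_algebra :: (daha_letter, 'a) free_algebra ring"
    by (rule ring_of_type_algebra_is_ring)
  have "ideal (genideal ring_of_type_algebra (daha_relations q s)) ring_of_type_algebra"
    by (rule F.genideal_ideal) (simp add: ring_of_type_algebra_def)
  then show ?thesis
    unfolding daha_GL2_def by (rule ideal.quotient_is_ring)
qed

end

theory Submission
  imports Defs
begin

text \<open>
  The algebra is reached from its scalars by adjoining pairs of elements, and each adjunction keeps
  the noetherian property by an argument in the style of Hilbert's basis theorem. Put
  \<open>P = Y\<^sub>2 T = T\<^sup>-\<^sup>1 Y\<^sub>1\<close>. The defining relations give \<open>P\<^sup>-\<^sup>1 X\<^sub>1 P = X\<^sub>2\<close>, \<open>P\<^sup>-\<^sup>1 X\<^sub>2 P = q\<^sup>-\<^sup>1 X\<^sub>1\<close>, and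
  \<open>P\<^sup>2 = Y\<^sub>1 Y\<^sub>2\<close> commutes with \<open>T\<close>. So conjugation by \<open>P\<close> exchanges \<open>T\<close> and \<open>T\<^sub>0 = P T P\<^sup>-\<^sup>1\<close>, and the
  algebra is built by adjoining to the scalars first \<open>X\<^sub>1\<^sup>\<plusminus>\<^sup>1\<close>, next \<open>X\<^sub>2\<^sup>\<plusminus>\<^sup>1\<close>, then \<open>T\<^sub>0\<close> and \<open>T\<close>
  together, and at last \<open>P\<^sup>\<plusminus>\<^sup>1\<close>. The first two steps and the last one are skew Laurent extensions. In the third step \<open>T\<^sub>0\<close> and \<open>T\<close> satisfy
  quadratic relations, so the new ring is spanned over the Laurent polynomials by the alternating
  words \<open>1, T\<^sub>0, T, T T\<^sub>0, T\<^sub>0 T, \<dots>\<close> of the infinite dihedral group.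

  Both kinds of step have a common form. There is a sequence \<open>E 0 = 1, E 1 = u, E 2 = v, \<dots>\<close> of
  words, two of each length, such that \<open>E (m + 2) = c m * E m\<close> for a letter \<open>c m\<close>, and every coefficient can be
  carried past a letter at the price of a term without that letter. For a left ideal \<open>I\<close> the
  coefficients \<open>p\<close> of the leading terms \<open>E m * p\<close> of elements of \<open>I\<close> form a left ideal \<open>L m\<close> of
  the coefficient ring, and left multiplication by \<open>c m\<close> shows \<open>L m \<subseteq> L (m + 2)\<close>. The doubly indexed family that
  an ascending chain of left ideals produces therefore becomes stationary uniformly in \<open>m\<close>, and an
  ideal is determined inside a larger one by its leading coefficients. Since
  \<open>L m\<close> collects all possible leading coefficients, linear relations between the words do no harm.
  The lemmas \<open>left_acc_filtered\<close> and \<open>left_noetherian_extension\<close> carry this part.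

  The facts about \<open>X\<^sub>1, X\<^sub>2, T, P\<close> on which the argument rests are invariant under reversing products and
  exchanging \<open>P\<close> with \<open>P\<^sup>-\<^sup>1\<close>. The right-hand version is thus the left-hand version in the
  opposite ring.

  All of this takes place in the free algebra itself, modulo the ideal \<open>J\<close> of relations: subrings,
  submodules and ideals of the quotient are represented by their preimages, which contain \<open>J\<close>.
\<close>

section \<open>Ascending chains of one-sided submodules\<close>

definition additive_set :: "'a::ring_1 set \<Rightarrow> bool"
  where "additive_set N \<longleftrightarrow> 0 \<in> N \<and> (\<forall>x\<in>N. \<forall>y\<in>N. x - y \<in> N)"

definition left_submodule :: "'a::ring_1 set \<Rightarrow> 'a set \<Rightarrow> bool"
  where "left_submodule B N \<longleftrightarrow> additive_set N \<and> (\<forall>b\<in>B. \<forall>x\<in>N. b * x \<in> N)"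

lemma additive_set_zero: "additive_set N \<Longrightarrow> 0 \<in> N"
  and additive_set_diff: "additive_set N \<Longrightarrow> x \<in> N \<Longrightarrow> y \<in> N \<Longrightarrow> x - y \<in> N"
  unfolding additive_set_def by auto

lemma additive_set_uminus: "additive_set N \<Longrightarrow> x \<in> N \<Longrightarrow> - x \<in> N"
  using additive_set_diff[of N 0 x] additive_set_zero[of N] by simp

lemma additive_set_add: "additive_set N \<Longrightarrow> x \<in> N \<Longrightarrow> y \<in> N \<Longrightarrow> x + y \<in> N"
  using additive_set_diff[of N x "- y"] additive_set_uminus[of N y] by simp

lemma left_submodule_additive: "left_submodule B N \<Longrightarrow> additive_set N"
  and left_submodule_mult: "left_submodule B N \<Longrightarrow> b \<in> B \<Longrightarrow> x \<in> N \<Longrightarrow> b * x \<in> N"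
  unfolding left_submodule_def by auto

text \<open>
  When \<open>J\<close> is an ideal and \<open>B\<close> a subring containing it, this is the ascending chain condition for
  left ideals of \<open>B / J\<close>, with each ideal replaced by its preimage.
\<close>

definition left_acc :: "'a::ring_1 set \<Rightarrow> 'a set \<Rightarrow> bool"
  where "left_acc J B \<longleftrightarrow>
    (\<forall>f :: nat \<Rightarrow> 'a set.
       (\<forall>n. left_submodule B (f n) \<and> J \<subseteq> f n \<and> f n \<subseteq> B) \<and> incseq f \<longrightarrow>
       (\<exists>N. \<forall>n\<ge>N. f n = f N))"

lemma left_accD:
  assumes "left_acc J B" "\<And>n. left_submodule B (f n)" "\<And>n. J \<subseteq> f n" "\<And>n. f n \<subseteq> B" "incseq f"
  obtains N where "\<And>n. n \<ge> N \<Longrightarrow> f n = f N"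
  using assms unfolding left_acc_def by meson

text \<open>
  If no finite set generated \<open>L\<close> over \<open>J\<close>, adding to a finite set an element of \<open>L\<close> outside its span, over and over
  again, would produce a strictly ascending chain of spans.
\<close>

lemma left_acc_finitely_generated:
  fixes J L :: "'a::ring_1 set"
  assumes acc: "left_acc J UNIV" and L: "left_submodule UNIV L" and "J \<subseteq> L"
  obtains S where "finite S" "S \<subseteq> L"
    "\<And>M. left_submodule UNIV M \<Longrightarrow> J \<subseteq> M \<Longrightarrow> S \<subseteq> M \<Longrightarrow> L \<subseteq> M"
proof -
  define span where "span S = \<Inter>{M. left_submodule UNIV M \<and> J \<subseteq> M \<and> S \<subseteq> M}" for S :: "'a set"
  have span: "left_submodule UNIV (span S)" for S
    unfolding span_def left_submodule_def additive_set_def by auto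
  have span_J: "J \<subseteq> span S" and span_sub: "S \<subseteq> span S" for S
    unfolding span_def by auto
  have span_mono: "span S \<subseteq> span S'" if "S \<subseteq> S'" for S S'
    using that unfolding span_def by auto
  have "\<exists>S. finite S \<and> S \<subseteq> L \<and> L \<subseteq> span S"
  proof (rule ccontr)
    assume neg: "\<nexists>S. finite S \<and> S \<subseteq> L \<and> L \<subseteq> span S"
    define good where "good S \<longleftrightarrow> finite S \<and> S \<subseteq> L" for S :: "'a set"
    have "\<exists>f. \<forall>n. good (f n) \<and> (f n \<subseteq> f (Suc n) \<and> \<not> f (Suc n) \<subseteq> span (f n))"
    proof (rule dependent_nat_choice)
      show "\<exists>S. good S"
        unfolding good_def by (rule exI[of _ "{}"]) simp
    next
      fix S and n :: nat
      assume "good S"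
      then obtain x where "x \<in> L" "x \<notin> span S"
        using neg unfolding good_def by blast
      with \<open>good S\<close> show "\<exists>S'. good S' \<and> S \<subseteq> S' \<and> \<not> S' \<subseteq> span S"
        unfolding good_def using span_sub by (intro exI[of _ "insert x S"]) auto
    qed
    then obtain f where "\<forall>n. good (f n) \<and> (f n \<subseteq> f (Suc n) \<and> \<not> f (Suc n) \<subseteq> span (f n))" ..
    then have f: "\<And>n. f n \<subseteq> f (Suc n)" "\<And>n. \<not> f (Suc n) \<subseteq> span (f n)"
      by simp_all
    have "incseq (\<lambda>n. span (f n))"
      by (intro incseq_SucI span_mono f(1))
    then obtain N where N: "\<And>n. n \<ge> N \<Longrightarrow> span (f n) = span (f N)"
      using left_accD[OF acc span span_J subset_UNIV] by metis
    have "span (f (Suc N)) = span (f N)"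
      by (rule N) simp
    then show False
      using f(2)[of N] span_sub by blast
  qed
  then obtain S where "finite S" "S \<subseteq> L" "L \<subseteq> span S"
    by blast
  then show thesis
    by (intro that[of S]) (auto simp: span_def)
qed

section \<open>Leading coefficients in filtered rings\<close>

text \<open>
  Along each residue class of \<open>m\<close> modulo \<open>d\<close> the diagonal \<open>n \<mapsto> L (d * n + e) n\<close> is an ascending
  chain. Once it is stationary, all entries of that class with both indices beyond this point agree.
  This leaves finitely many rows, each of them stationary by itself.
\<close>

lemma double_chain_stationary:
  fixes L :: "nat \<Rightarrow> nat \<Rightarrow> 'b set"
  assumes d: "d > 0"
    and acc: "\<And>f. (\<And>n. f n \<in> \<C>) \<Longrightarrow> incseq f \<Longrightarrow> \<exists>N. \<forall>n\<ge>N. f n = f N"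
    and L: "\<And>m j. L m j \<in> \<C>"
    and mono_j: "\<And>m. incseq (L m)"
    and shift: "\<And>m j. L m j \<subseteq> L (m + d) j"
  shows "\<exists>N. \<forall>j\<ge>N. \<forall>m. L m j = L m N"
proof -
  have mono: "L (d * i + e) j \<subseteq> L (d * i' + e) j'" if "i \<le> i'" "j \<le> j'" for i i' j j' e
  proof -
    have "L (d * i + e) j \<subseteq> L (d * i' + e) j"
      using \<open>i \<le> i'\<close>
    proof (induction i' rule: dec_induct)
      case (step n)
      then show ?case
        using shift[of "d * n + e" j] by (simp add: algebra_simps)
    qed simp
    also have "\<dots> \<subseteq> L (d * i' + e) j'"
      using mono_j \<open>j \<le> j'\<close> by (auto simp: incseq_def)
    finally show ?thesis .
  qed
  have "\<exists>N. \<forall>n\<ge>N. L (d * n + e) n = L (d * N + e) N" for e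
    by (rule acc) (use L mono in \<open>auto simp: incseq_def\<close>)
  then obtain D where D: "\<And>e n. n \<ge> D e \<Longrightarrow> L (d * n + e) n = L (d * D e + e) (D e)"
    by metis
  have diagonal: "L (d * i + e) j = L (d * D e + e) (D e)" if "i \<ge> D e" "j \<ge> D e" for i j e
  proof
    show "L (d * D e + e) (D e) \<subseteq> L (d * i + e) j"
      by (rule mono) (use that in auto)
    have "L (d * i + e) j \<subseteq> L (d * max i j + e) (max i j)"
      by (rule mono) auto
    also have "\<dots> = L (d * D e + e) (D e)"
      by (rule D) (use that in auto)
    finally show "L (d * i + e) j \<subseteq> L (d * D e + e) (D e)" .
  qed
  have "\<exists>N. \<forall>j\<ge>N. L m j = L m N" for m
    by (rule acc) (use L mono_j in auto)
  then obtain C where C: "\<And>m j. j \<ge> C m \<Longrightarrow> L m j = L m (C m)"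
    by metis
  define M where "M = Max (D ` {..<d})"
  define N where "N = Max (insert M (C ` {..<d * M}))"
  have M: "D e \<le> M" if "e < d" for e
    unfolding M_def using that by (intro Max_ge) auto
  have N: "M \<le> N" "m < d * M \<Longrightarrow> C m \<le> N" for m
    unfolding N_def by (auto intro!: Max_ge)
  have "L m j = L m N" if "j \<ge> N" for m j
  proof (cases "m < d * M")
    case True
    then show ?thesis
      using C[of m j] C[of m N] N(2)[of m] that by simp
  next
    case False
    define i e where "i = m div d" and "e = m mod d"
    have m: "m = d * i + e" and "e < d"
      using d by (simp_all add: i_def e_def)
    have "M \<le> i"
      using False d by (simp add: i_def less_eq_div_iff_mult_less_eq mult.commute)
    then show ?thesis
      using diagonal[of e i j] diagonal[of e i N] M[OF \<open>e < d\<close>] N(1) that unfolding m by simp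
  qed
  then show ?thesis
    by blast
qed

text \<open>
  Hilbert's basis theorem for a ring \<open>A\<close> exhausted by \<open>G 0 \<subseteq> G 1 \<subseteq> \<dots>\<close>, where \<open>G (Suc m)\<close> has over
  \<open>G m\<close> the single new generator \<open>E m\<close>. Coefficients are written on the right of \<open>E m\<close>: then
  multiplication by \<open>c m\<close> takes a leading term \<open>E m * p\<close> to \<open>E (m + d) * p\<close> with the
  same \<open>p\<close>, and no twisting automorphism of \<open>B\<close> enters. That leading coefficients nevertheless form a left ideal
  of \<open>B\<close> is due to the assumption \<open>normal\<close>.
\<close>

lemma left_acc_filtered:
  fixes J B A :: "'a::ring_1 set" and E :: "nat \<Rightarrow> 'a" and G :: "nat \<Rightarrow> 'a set"
  assumes acc: "left_acc J B" and "d > 0"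
    and B: "left_submodule B B" "J \<subseteq> B" "B \<subseteq> A"
    and J: "\<And>x y. x \<in> J \<Longrightarrow> y * x \<in> J"
    and G: "\<And>m. left_submodule B (G m)" "\<And>m g p. g \<in> G m \<Longrightarrow> p \<in> B \<Longrightarrow> g * p \<in> G m"
    and G_0: "G 0 = J" and G_Suc: "\<And>m x. x \<in> G (Suc m) \<Longrightarrow> \<exists>p\<in>B. x - E m * p \<in> G m"
    and J_G: "\<And>m. J \<subseteq> G m"
    and A: "A = (\<Union>m. G m)"
    and normal: "\<And>m r. r \<in> B \<Longrightarrow> \<exists>r'\<in>B. E m * r - r' * E m \<in> G m"
    and shift: "\<And>m. c m \<in> A" "\<And>m. E (m + d) = c m * E m" "\<And>m g. g \<in> G m \<Longrightarrow> c m * g \<in> G (m + d)"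
  shows "left_acc J A"
  unfolding left_acc_def
proof (intro allI impI, elim conjE)
  fix I :: "nat \<Rightarrow> 'a set"
  assume I: "\<forall>j. left_submodule A (I j) \<and> J \<subseteq> I j \<and> I j \<subseteq> A" and inc: "incseq I"
  note G_add = left_submodule_additive[OF G(1)] and I_add = left_submodule_additive[OF I[rule_format, THEN conjunct1]]
  note I_mult = left_submodule_mult[OF I[rule_format, THEN conjunct1]]
  (* coefficients of E m among the elements of I j that lie in G (Suc m) *)
  define lead where "lead m j = {p \<in> B. \<exists>i\<in>I j. E m * p - i \<in> G m}" for m j
  have lead: "left_submodule B (lead m j)" for m j
    unfolding left_submodule_def additive_set_def
  proof (intro conjI ballI)
    show "0 \<in> lead m j"
      using additive_set_zero[OF G_add] additive_set_zero[OF I_add]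
        additive_set_zero[OF left_submodule_additive[OF B(1)]]
      by (auto simp: lead_def intro!: bexI[of _ 0])
  next
    fix x y assume "x \<in> lead m j" "y \<in> lead m j"
    then obtain i i' where *: "x \<in> B" "y \<in> B" "i \<in> I j" "i' \<in> I j" "E m * x - i \<in> G m" "E m * y - i' \<in> G m"
      by (auto simp: lead_def)
    have "E m * (x - y) - (i - i') = (E m * x - i) - (E m * y - i')"
      by (simp add: algebra_simps)
    then have "E m * (x - y) - (i - i') \<in> G m"
      using additive_set_diff[OF G_add *(5,6)] by metis
    then show "x - y \<in> lead m j"
      using additive_set_diff[OF I_add *(3,4)]
        additive_set_diff[OF left_submodule_additive[OF B(1)] *(1,2)]
      by (auto simp: lead_def)
  next
    fix r p assume r: "r \<in> B" and "p \<in> lead m j"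
    then obtain i where *: "p \<in> B" "i \<in> I j" "E m * p - i \<in> G m"
      by (auto simp: lead_def)
    obtain r' where r': "r' \<in> B" "E m * r - r' * E m \<in> G m"
      using normal[OF r] by blast
    have "E m * (r * p) - r' * i = (E m * r - r' * E m) * p + r' * (E m * p - i)"
      by (simp add: algebra_simps)
    then have "E m * (r * p) - r' * i \<in> G m"
      using additive_set_add[OF G_add G(2)[OF r'(2) *(1)] left_submodule_mult[OF G(1) r'(1) *(3)]]
      by simp
    moreover have "r' * i \<in> I j"
      by (rule I_mult) (use r'(1) B(3) *(2) in auto)
    ultimately show "r * p \<in> lead m j"
      using left_submodule_mult[OF B(1) r *(1)] by (auto simp: lead_def)
  qed
  have "\<exists>N. \<forall>j\<ge>N. \<forall>m. lead m j = lead m N"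
  proof (rule double_chain_stationary[where \<C> = "{N. left_submodule B N \<and> J \<subseteq> N \<and> N \<subseteq> B}", OF \<open>d > 0\<close>])
    fix f :: "nat \<Rightarrow> 'a set"
    assume "\<And>n. f n \<in> {N. left_submodule B N \<and> J \<subseteq> N \<and> N \<subseteq> B}" "incseq f"
    then show "\<exists>N. \<forall>n\<ge>N. f n = f N"
      using acc unfolding left_acc_def by blast
  next
    fix m j
    have "p \<in> lead m j" if "p \<in> J" for p
      using that B(2) J[OF that, of "E m"] J_G[of m] additive_set_zero[OF I_add]
      by (auto simp: lead_def intro!: bexI[of _ 0])
    then show "lead m j \<in> {N. left_submodule B N \<and> J \<subseteq> N \<and> N \<subseteq> B}"
      using lead by (auto simp: lead_def)
  next
    show "incseq (lead m)" for m
      using inc by (fastforce simp: lead_def incseq_def)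
  next
    fix m j
    show "lead m j \<subseteq> lead (m + d) j"
    proof
      fix p assume "p \<in> lead m j"
      then obtain i where *: "p \<in> B" "i \<in> I j" "E m * p - i \<in> G m"
        by (auto simp: lead_def)
      have "E (m + d) * p - c m * i = c m * (E m * p - i)"
        unfolding shift(2) by (simp add: algebra_simps)
      then have "E (m + d) * p - c m * i \<in> G (m + d)"
        using shift(3)[OF *(3)] by simp
      moreover have "c m * i \<in> I j"
        by (rule I_mult[OF shift(1) *(2)])
      ultimately show "p \<in> lead (m + d) j"
        using *(1) by (auto simp: lead_def)
    qed
  qed
  then obtain N where N: "\<And>j m. j \<ge> N \<Longrightarrow> lead m j = lead m N"
    by blast
  have "I j \<subseteq> I N" if "j \<ge> N" for j
  proof -
    have sub: "I N \<subseteq> I j"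
      using inc that by (simp add: incseq_def)
    (* equal leading coefficients: subtracting an element of I N lowers the filtration degree *)
    have "I j \<inter> G m \<subseteq> I N" for m
    proof (induction m)
      case 0
      then show ?case
        using I G_0 by auto
    next
      case (Suc m)
      show ?case
      proof
        fix x assume x: "x \<in> I j \<inter> G (Suc m)"
        then obtain p where p: "p \<in> B" "x - E m * p \<in> G m"
          using G_Suc by blast
        have "E m * p - x \<in> G m"
          using additive_set_uminus[OF G_add p(2)] by simp
        then have "p \<in> lead m j"
          using x p(1) by (auto simp: lead_def)
        then have "p \<in> lead m N"
          using N[OF that] by simp
        then obtain i where i: "i \<in> I N" "E m * p - i \<in> G m"
          by (auto simp: lead_def)
        have "x - i = (x - E m * p) + (E m * p - i)"
          by simp
        then have "x - i \<in> G m"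
          using additive_set_add[OF G_add p(2) i(2)] by simp
        moreover have "x - i \<in> I j"
          by (rule additive_set_diff[OF I_add]) (use x i(1) sub in auto)
        ultimately have "x - i \<in> I N"
          using Suc.IH by blast
        then show "x \<in> I N"
          using additive_set_add[OF I_add _ i(1), of "x - i"] by simp
      qed
    qed
    moreover have "I j \<subseteq> (\<Union>m. G m)"
      using I A by blast
    ultimately show ?thesis
      by blast
  qed
  then have "\<forall>j\<ge>N. I j = I N"
    using inc unfolding incseq_def by (intro allI impI equalityI) auto
  then show "\<exists>N. \<forall>j\<ge>N. I j = I N"
    by blast
qed

section \<open>Computing modulo a two-sided ideal\<close>

locale two_sided_ideal =
  fixes J :: "'a::ring_1 set"
  assumes J_additive: "additive_set J"
    and J_left: "x \<in> J \<Longrightarrow> y * x \<in> J"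
    and J_right: "x \<in> J \<Longrightarrow> x * y \<in> J"
begin

text \<open>
  Including \<open>J\<close> makes these sets the preimages of subrings of the quotient, so that membership
  depends on congruence classes only.
\<close>

inductive_set subring_gen :: "'a set \<Rightarrow> 'a set" for S
  where
    ideal: "x \<in> J \<Longrightarrow> x \<in> subring_gen S"
  | generator: "x \<in> S \<Longrightarrow> x \<in> subring_gen S"
  | one: "1 \<in> subring_gen S"
  | diff: "x \<in> subring_gen S \<Longrightarrow> y \<in> subring_gen S \<Longrightarrow> x - y \<in> subring_gen S"
  | mult: "x \<in> subring_gen S \<Longrightarrow> y \<in> subring_gen S \<Longrightarrow> x * y \<in> subring_gen S"

lemma subring_gen_additive: "additive_set (subring_gen S)"
  unfolding additive_set_def
  using additive_set_zero[OF J_additive] by (auto intro: subring_gen.intros)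

lemmas subring_gen_zero = additive_set_zero[OF subring_gen_additive]
  and subring_gen_uminus = additive_set_uminus[OF subring_gen_additive]
  and subring_gen_add = additive_set_add[OF subring_gen_additive]

lemma subring_gen_mono: "S \<subseteq> S' \<Longrightarrow> x \<in> subring_gen S \<Longrightarrow> x \<in> subring_gen S'"
  by (rotate_tac, induction rule: subring_gen.induct) (auto intro: subring_gen.intros)

definition cong :: "'a \<Rightarrow> 'a \<Rightarrow> bool" (infix "\<doteq>" 50)
  where "x \<doteq> y \<longleftrightarrow> x - y \<in> J"

lemma cong_refl [simp]: "x \<doteq> x"
  using additive_set_zero[OF J_additive] by (simp add: cong_def)

lemma cong_sym: "x \<doteq> y \<Longrightarrow> y \<doteq> x"
  using additive_set_uminus[OF J_additive, of "x - y"] by (simp add: cong_def)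

lemma cong_trans [trans]: "x \<doteq> y \<Longrightarrow> y \<doteq> z \<Longrightarrow> x \<doteq> z"
  using additive_set_add[OF J_additive, of "x - y" "y - z"] by (simp add: cong_def)

lemma cong_add: "x \<doteq> y \<Longrightarrow> x' \<doteq> y' \<Longrightarrow> x + x' \<doteq> y + y'"
  using additive_set_add[OF J_additive, of "x - y" "x' - y'"] by (simp add: cong_def algebra_simps)

lemma cong_diff: "x \<doteq> y \<Longrightarrow> x' \<doteq> y' \<Longrightarrow> x - x' \<doteq> y - y'"
  using additive_set_diff[OF J_additive, of "x - y" "x' - y'"] by (simp add: cong_def algebra_simps)

lemma cong_mid: "x \<doteq> y \<Longrightarrow> a * x * b \<doteq> a * y * b"
  using J_right[OF J_left, of "x - y" a b] by (simp add: cong_def algebra_simps)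

lemmas cong_left = cong_mid[where b = 1, simplified]
  and cong_right = cong_mid[where a = 1, simplified]

lemma cong_mult: "x \<doteq> y \<Longrightarrow> x' \<doteq> y' \<Longrightarrow> x * x' \<doteq> y * y'"
  using cong_trans[OF cong_right[of x y x'] cong_left[of x' y' y]] by simp

lemma subring_gen_cong: "x \<doteq> y \<Longrightarrow> y \<in> subring_gen S \<Longrightarrow> x \<in> subring_gen S"
  using subring_gen_add[OF subring_gen.ideal, of "x - y" y S] by (simp add: cong_def)

lemma conjugate_inverse:
  assumes conj: "z * r * z' \<doteq> w" and "z' * z \<doteq> 1" "z * z' \<doteq> 1" "r * r' \<doteq> 1" "w' * w \<doteq> 1"
  shows "z * r' * z' \<doteq> w'"
proof -
  have "z * r' * z' \<doteq> w' * w * (z * r' * z')"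
    using cong_right[OF cong_sym[OF assms(5)], of "z * r' * z'"] by (simp add: mult.assoc)
  also have "\<dots> \<doteq> w' * (z * r * z') * (z * r' * z')"
    using cong_mid[OF cong_sym[OF conj], of w' "z * r' * z'"] by (simp add: mult.assoc)
  also have "\<dots> \<doteq> w' * z * r * r' * z'"
    using cong_mid[OF assms(2), of "w' * z * r" "r' * z'"] by (simp add: mult.assoc)
  also have "\<dots> \<doteq> w' * z * z'"
    using cong_mid[OF assms(4), of "w' * z" "z'"] by (simp add: mult.assoc)
  also have "\<dots> \<doteq> w'"
    using cong_left[OF assms(3), of "w'"] by (simp add: mult.assoc)
  finally show ?thesis .
qed

lemma conjugate_swap:
  assumes "z * r * z' \<doteq> w" "z' * z \<doteq> 1"
  shows "z' * w * z \<doteq> r"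
proof -
  have "z' * w * z \<doteq> z' * (z * r * z') * z"
    using cong_mid[OF cong_sym[OF assms(1)]] .
  also have "\<dots> \<doteq> r * z' * z"
    using cong_right[OF assms(2), of "r * z' * z"] by (simp add: mult.assoc)
  also have "\<dots> \<doteq> r"
    using cong_left[OF assms(2), of r] by (simp add: mult.assoc)
  finally show ?thesis .
qed

text \<open>
  The typical case is a Demazure-Lusztig operator \<open>z\<close> and a coefficient \<open>r\<close>: passing
  \<open>r\<close> across \<open>z\<close> changes \<open>r\<close> and leaves a remainder free of \<open>z\<close>. The two directions are separate notions
  because a product can be reordered either way, and each becomes the other in the opposite ring.
\<close>

definition moves_left :: "'a set \<Rightarrow> 'a \<Rightarrow> 'a \<Rightarrow> bool"
  where "moves_left S z r \<longleftrightarrow> (\<exists>p\<in>subring_gen S. \<exists>p'\<in>subring_gen S. z * r = p * z + p')"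

definition moves_right :: "'a set \<Rightarrow> 'a \<Rightarrow> 'a \<Rightarrow> bool"
  where "moves_right S z r \<longleftrightarrow> (\<exists>p\<in>subring_gen S. \<exists>p'\<in>subring_gen S. r * z = z * p + p')"

lemma moves_leftI:
  assumes "z * r \<doteq> p * z + p'" "p \<in> subring_gen S" "p' \<in> subring_gen S"
  shows "moves_left S z r"
proof -
  have "z * r - p * z \<in> subring_gen S"
    using subring_gen_cong[of "z * r - p * z" p' S] assms by (simp add: cong_def algebra_simps)
  then show ?thesis
    unfolding moves_left_def using assms(2) by (intro bexI[of _ p] bexI[of _ "z * r - p * z"]) auto
qed

lemma moves_rightI:
  assumes "r * z \<doteq> z * p + p'" "p \<in> subring_gen S" "p' \<in> subring_gen S"
  shows "moves_right S z r"
proof -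
  have "r * z - z * p \<in> subring_gen S"
    using subring_gen_cong[of "r * z - z * p" p' S] assms by (simp add: cong_def algebra_simps)
  then show ?thesis
    unfolding moves_right_def using assms(2) by (intro bexI[of _ p] bexI[of _ "r * z - z * p"]) auto
qed

text \<open>
  Moving past \<open>x\<close> and then past \<open>y\<close> moves past \<open>x * y\<close>, so it is enough to check generators.
\<close>

lemma moves_left_gen:
  assumes "\<And>r. r \<in> S \<Longrightarrow> moves_left S z r" "r \<in> subring_gen S"
  shows "moves_left S z r"
  using assms(2)
proof induction
  case (ideal x)
  then show ?case
    by (intro moves_leftI[where p = 0 and p' = 0])
       (auto simp: cong_def J_left intro: subring_gen_zero)
next
  case one
  then show ?case
    by (rule moves_leftI[where p = 1 and p' = 0]) (auto intro: subring_gen.one subring_gen_zero)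
next
  case (diff x y)
  then obtain p p' s s' where *: "z * x = p * z + p'" "z * y = s * z + s'"
    "p \<in> subring_gen S" "p' \<in> subring_gen S" "s \<in> subring_gen S" "s' \<in> subring_gen S"
    by (auto simp: moves_left_def)
  show ?case
    by (rule moves_leftI[where p = "p - s" and p' = "p' - s'"])
       (use * in \<open>auto simp: algebra_simps intro: subring_gen.diff\<close>)
next
  case (mult x y)
  then obtain p p' s s' where *: "z * x = p * z + p'" "z * y = s * z + s'"
    "p \<in> subring_gen S" "p' \<in> subring_gen S" "s \<in> subring_gen S" "s' \<in> subring_gen S"
    by (auto simp: moves_left_def)
  have "z * (x * y) = p * (z * y) + p' * y"
    by (simp add: *(1) algebra_simps flip: mult.assoc)
  also have "\<dots> = (p * s) * z + (p * s' + p' * y)"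
    by (simp add: *(2) algebra_simps)
  finally show ?case
    using * mult.hyps
    by (intro moves_leftI[where p = "p * s" and p' = "p * s' + p' * y"])
       (auto intro: subring_gen_add subring_gen.mult)
qed (rule assms(1))

lemma moves_right_gen:
  assumes "\<And>r. r \<in> S \<Longrightarrow> moves_right S z r" "r \<in> subring_gen S"
  shows "moves_right S z r"
  using assms(2)
proof induction
  case (ideal x)
  then show ?case
    by (intro moves_rightI[where p = 0 and p' = 0])
       (auto simp: cong_def J_right intro: subring_gen_zero)
next
  case one
  then show ?case
    by (rule moves_rightI[where p = 1 and p' = 0]) (auto intro: subring_gen.one subring_gen_zero)
next
  case (diff x y)
  then obtain p p' s s' where *: "x * z = z * p + p'" "y * z = z * s + s'"
    "p \<in> subring_gen S" "p' \<in> subring_gen S" "s \<in> subring_gen S" "s' \<in> subring_gen S"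
    by (auto simp: moves_right_def)
  show ?case
    by (rule moves_rightI[where p = "p - s" and p' = "p' - s'"])
       (use * in \<open>auto simp: algebra_simps intro: subring_gen.diff\<close>)
next
  case (mult x y)
  then obtain p p' s s' where *: "x * z = z * p + p'" "y * z = z * s + s'"
    "p \<in> subring_gen S" "p' \<in> subring_gen S" "s \<in> subring_gen S" "s' \<in> subring_gen S"
    by (auto simp: moves_right_def)
  have "x * y * z = x * z * s + x * s'"
    by (simp add: *(2) algebra_simps)
  also have "\<dots> = z * (p * s) + (p' * s + x * s')"
    by (simp add: *(1) algebra_simps)
  finally show ?case
    using * mult.hyps
    by (intro moves_rightI[where p = "p * s" and p' = "p' * s + x * s'"])
       (auto intro: subring_gen_add subring_gen.mult)
qed (rule assms(1))

abbreviation left_noetherian_gen :: "'a set \<Rightarrow> bool"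
  where "left_noetherian_gen S \<equiv> left_acc J (subring_gen S)"

end

section \<open>Adjoining two letters\<close>

text \<open>
  The words of even index end in \<open>v\<close> and those of odd index in \<open>u\<close>, provided \<open>c 0 = v\<close>; they grow
  at their left ends. With \<open>c\<close> alternating between \<open>y\<close> and \<open>x\<close> they are the powers of
  \<open>x\<close> and of \<open>y\<close>; with \<open>c\<close> of period four they are the reduced words of the infinite dihedral
  group.
\<close>

fun end_words :: "'a::ring_1 \<Rightarrow> (nat \<Rightarrow> 'a) \<Rightarrow> nat \<Rightarrow> 'a"
  where
    "end_words u c 0 = 1"
  | "end_words u c (Suc 0) = u"
  | "end_words u c (Suc (Suc m)) = c m * end_words u c m"

text \<open>
  The assumptions \<open>step_first\<close> and \<open>step\<close> say that a letter put in front of a word either continues it or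
  meets its first letter in a product that can be shortened. The first letter of \<open>E (j + 2)\<close> is
  \<open>c j\<close>, and the letter continuing it is \<open>c (j + 2)\<close>.
\<close>

locale two_ended_extension = two_sided_ideal J for J :: "'a::ring_1 set" +
  fixes S :: "'a set" and u v :: 'a and c :: "nat \<Rightarrow> 'a"
  assumes letters: "c m \<in> {u, v}" "c 0 = v"
    and step_first: "z \<in> {u, v} \<Longrightarrow>
      z = c 1 \<or> (\<exists>p\<in>subring_gen S. \<exists>p'\<in>subring_gen S. z * u = p * u + p')"
    and step: "z \<in> {u, v} \<Longrightarrow>
      z = c (Suc (Suc j)) \<or> (\<exists>p\<in>subring_gen S. \<exists>p'\<in>subring_gen S. z * c j = p * c j + p')"
    and moves: "z \<in> {u, v} \<Longrightarrow> r \<in> S \<Longrightarrow> moves_left S z r \<and> moves_right S z r"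
begin

abbreviation "B \<equiv> subring_gen S"
abbreviation "E \<equiv> end_words u c"

lemma left_to_right: "z \<in> {u, v} \<Longrightarrow> r \<in> B \<Longrightarrow> \<exists>p\<in>B. \<exists>p'\<in>B. z * r = p * z + p'"
  and right_to_left: "z \<in> {u, v} \<Longrightarrow> r \<in> B \<Longrightarrow> \<exists>p\<in>B. \<exists>p'\<in>B. r * z = z * p + p'"
  using moves_left_gen[of S z r] moves_right_gen[of S z r] moves
  unfolding moves_left_def moves_right_def by blast+

text \<open>
  \<open>filt m\<close> is the span of the first \<open>m\<close> words, not the span of the words of length at most \<open>m\<close>: listing the two
  words of each length one after the other leaves one leading coefficient per degree.
\<close>

fun filt :: "nat \<Rightarrow> 'a set"
  where
    "filt 0 = J"
  | "filt (Suc m) = {E m * p + g | p g. p \<in> B \<and> g \<in> filt m}"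

lemma filtI: "p \<in> B \<Longrightarrow> g \<in> filt m \<Longrightarrow> E m * p + g \<in> filt (Suc m)"
  by auto

lemma filtE:
  assumes "x \<in> filt (Suc m)"
  obtains p g where "x = E m * p + g" "p \<in> B" "g \<in> filt m"
  using assms by auto

declare filt.simps(2) [simp del]

lemma filt_additive: "additive_set (filt m)"
proof (induction m)
  case 0
  then show ?case using J_additive by simp
next
  case (Suc m)
  show ?case
    unfolding additive_set_def
  proof (intro conjI ballI)
    show "0 \<in> filt (Suc m)"
      using filtI[OF subring_gen_zero additive_set_zero[OF Suc]] by simp
  next
    fix x y assume "x \<in> filt (Suc m)" "y \<in> filt (Suc m)"
    then obtain p g p' g' where *: "x = E m * p + g" "y = E m * p' + g'"
      "p \<in> B" "p' \<in> B" "g \<in> filt m" "g' \<in> filt m"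
      by (metis filtE)
    have "x - y = E m * (p - p') + (g - g')"
      using * by (simp add: algebra_simps)
    then show "x - y \<in> filt (Suc m)"
      using filtI[OF subring_gen.diff additive_set_diff[OF Suc]] *(3-) by metis
  qed
qed

lemmas filt_zero = additive_set_zero[OF filt_additive]
  and filt_add = additive_set_add[OF filt_additive]
  and filt_diff = additive_set_diff[OF filt_additive]

lemma filt_mono:
  assumes "m \<le> n" "x \<in> filt m"
  shows "x \<in> filt n"
  using assms(1)
proof (induction n rule: dec_induct)
  case base
  then show ?case using assms(2) .
next
  case (step n)
  then show ?case
    using filtI[OF subring_gen_zero, of x n] by simp
qed

lemma ideal_filt: "J \<subseteq> filt m"
  using filt_mono[of 0 m] by auto

lemma word_filt: "m < n \<Longrightarrow> p \<in> B \<Longrightarrow> E m * p \<in> filt n"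
  using filt_mono[of "Suc m" n] filtI[OF _ filt_zero, of p m] by simp

lemma word_in_filt: "m < n \<Longrightarrow> E m \<in> filt n"
  using word_filt[of m n 1] subring_gen.one by simp

lemma filt_right: "g \<in> filt m \<Longrightarrow> r \<in> B \<Longrightarrow> g * r \<in> filt m"
proof (induction m arbitrary: g)
  case 0
  then show ?case using J_right by simp
next
  case (Suc m)
  then obtain p h where "g = E m * p + h" "p \<in> B" "h \<in> filt m"
    by (auto elim: filtE)
  then show ?case
    using filtI[OF subring_gen.mult Suc.IH, of p r h] Suc.prems by (simp add: algebra_simps)
qed

text \<open>
  The bound \<open>left\<close> on coefficients in front of shorter words is proved together with this one in
  an induction that is completed in \<open>left_word\<close>.
\<close>

lemma letter_word:
  assumes z: "z \<in> {u, v}" and left: "\<And>i r. i \<le> j \<Longrightarrow> r \<in> B \<Longrightarrow> r * E i \<in> filt (Suc i)"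
  shows "z * E j \<in> filt (Suc j) \<or> z * E j = E (Suc (Suc j)) \<or> j = 0"
proof -
  consider "j = 0" | "j = 1" | i where "j = Suc (Suc i)"
    by (metis One_nat_def not0_implies_Suc)
  then show ?thesis
  proof cases
    case 2
    show ?thesis
    proof (cases "z = c 1")
      case False
      then obtain p p' where *: "p \<in> B" "p' \<in> B" "z * u = p * u + p'"
        using step_first[OF z] by blast
      have "z * E 1 = p * E 1 + p' * E 0"
        using * by simp
      moreover have "p' * E 0 \<in> filt (Suc 1)"
        using filt_mono[of 1 2 "p' * E 0"] left[of 0 p'] * by (simp add: numeral_2_eq_2)
      ultimately show ?thesis
        using left[of 1 p] * filt_add 2 by simp
    qed (use 2 in simp)
  next
    case 3
    show ?thesis
    proof (cases "z = c j")
      case False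
      then obtain p p' where *: "p \<in> B" "p' \<in> B" "z * c i = p * c i + p'"
        using step[OF z, of i] 3 by blast
      have "z * E j = (z * c i) * E i"
        using 3 by (simp add: mult.assoc)
      also have "\<dots> = p * E j + p' * E i"
        using * 3 by (simp add: algebra_simps)
      finally have "z * E j = p * E j + p' * E i" .
      moreover have "p' * E i \<in> filt (Suc j)"
        using filt_mono[of "Suc i" "Suc j"] left[of i p'] * 3 by simp
      ultimately show ?thesis
        using left[of j p] * filt_add by simp
    qed (use 3 in simp)
  qed simp
qed

lemma letter_unit: "z \<in> {u, v} \<Longrightarrow> z \<in> filt 3"
  using word_in_filt[of 1 3] word_in_filt[of 2 3] letters(2) by (auto simp: numeral_2_eq_2)

text \<open>
  A letter raises the degree by at most two even when it continues the last word \<open>E k\<close> of the span, because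
  \<open>k < m\<close>. The empty word is continued by either letter, and both letters are among the first three words.
\<close>

lemma letter_filt_aux:
  assumes left: "\<And>i r. i < m \<Longrightarrow> r \<in> B \<Longrightarrow> r * E i \<in> filt (Suc i)"
    and z: "z \<in> {u, v}" and g: "g \<in> filt m"
  shows "z * g \<in> filt (Suc (Suc m))"
proof -
  have "z * h \<in> filt (Suc (Suc m))" if "h \<in> filt k" "k \<le> m" for h k
    using that
  proof (induction k arbitrary: h)
    case 0
    then show ?case
      using J_left ideal_filt[of "Suc (Suc m)"] by auto
  next
    case (Suc k)
    then obtain p h' where h: "h = E k * p + h'" "p \<in> B" "h' \<in> filt k"
      by (auto elim: filtE)
    have "z * E k \<in> filt (Suc (Suc m))"
    proof -
      consider "z * E k \<in> filt (Suc k)" | "z * E k = E (Suc (Suc k))" | "k = 0"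
        using letter_word[OF z, of k] left Suc.prems(2) by force
      then show ?thesis
      proof cases
        case 1
        then show ?thesis using filt_mono[of "Suc k" "Suc (Suc m)"] Suc.prems(2) by simp
      next
        case 2
        then show ?thesis using word_in_filt[of "Suc (Suc k)" "Suc (Suc m)"] Suc.prems(2) by simp
      next
        case 3
        then show ?thesis using filt_mono[of 3 "Suc (Suc m)"] letter_unit[OF z] Suc.prems(2) by simp
      qed
    qed
    then have "z * E k * p \<in> filt (Suc (Suc m))"
      using filt_right h(2) by blast
    then show ?case
      using filt_add[of "z * E k * p" "Suc (Suc m)" "z * h'"] Suc.IH[OF h(3)] Suc.prems(2) h(1)
      by (simp add: algebra_simps)
  qed
  then show ?thesis
    using g by blast
qed

text \<open>
  A coefficient in front of \<open>E m\<close> is carried through the first letter, then through the rest of the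
  word by induction; the letter returns only in front of a span of shorter words.
\<close>

lemma left_word: "r \<in> B \<Longrightarrow> r * E m \<in> filt (Suc m)"
proof (induction m arbitrary: r rule: less_induct)
  case (less m)
  consider "m = 0" | "m = 1" | n where "m = Suc (Suc n)"
    by (metis One_nat_def not0_implies_Suc)
  then show ?case
  proof cases
    case 1
    then show ?thesis
      using word_filt[of 0 1 r] less.prems by simp
  next
    case 2
    obtain p p' where *: "p \<in> B" "p' \<in> B" "r * u = u * p + p'"
      using right_to_left[of u r] less.prems by blast
    have "r * E 1 = E 1 * p + E 0 * p'"
      using * by simp
    then show ?thesis
      using filtI[of p "E 0 * p'" 1] word_filt[of 0 1 p'] * 2 by simp
  next
    case 3
    obtain p p' where *: "p \<in> B" "p' \<in> B" "r * c n = c n * p + p'"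
      using right_to_left[of "c n" r] letters(1) less.prems by blast
    have "p * E n \<in> filt (Suc n)" and p'E: "p' * E n \<in> filt (Suc n)"
      using less.IH[of n] * 3 by simp_all
    then obtain p'' g where g: "p * E n = E n * p'' + g" "p'' \<in> B" "g \<in> filt n"
      by (auto elim: filtE)
    have "r * E m = (r * c n) * E n"
      using 3 by (simp add: mult.assoc)
    also have "\<dots> = c n * (p * E n) + p' * E n"
      unfolding *(3) by (simp add: algebra_simps)
    also have "\<dots> = E m * p'' + (c n * g + p' * E n)"
      using 3 by (simp add: g(1) algebra_simps)
    finally have "r * E m = E m * p'' + (c n * g + p' * E n)" .
    moreover have "c n * g \<in> filt m"
      using letter_filt_aux[OF _ letters(1) g(3)] less.IH 3 by simp
    moreover have "p' * E n \<in> filt m"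
      using filt_mono[OF _ p'E, of m] 3 by simp
    ultimately show ?thesis
      using filtI[OF g(2) filt_add, of "c n * g" m "p' * E n"] by simp
  qed
qed

lemma letter_filt: "z \<in> {u, v} \<Longrightarrow> g \<in> filt m \<Longrightarrow> z * g \<in> filt (Suc (Suc m))"
  by (rule letter_filt_aux) (auto intro: left_word)

lemma filt_left: "r \<in> B \<Longrightarrow> g \<in> filt m \<Longrightarrow> r * g \<in> filt m"
proof (induction m arbitrary: g)
  case 0
  then show ?case using J_left by simp
next
  case (Suc m)
  then obtain p h where h: "g = E m * p + h" "p \<in> B" "h \<in> filt m"
    by (auto elim: filtE)
  have "r * g = r * E m * p + r * h"
    by (simp add: h(1) algebra_simps)
  moreover have "r * E m * p \<in> filt (Suc m)"
    using filt_right[OF left_word] Suc.prems(1) h(2) by blast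
  moreover have "r * h \<in> filt (Suc m)"
    using filt_mono[of m "Suc m"] Suc.IH[OF Suc.prems(1) h(3)] by simp
  ultimately show ?case
    using filt_add by metis
qed

lemma word_normal: "r \<in> B \<Longrightarrow> \<exists>r'\<in>B. E m * r - r' * E m \<in> filt m"
proof (induction m arbitrary: r rule: less_induct)
  case (less m)
  consider "m = 0" | "m = 1" | n where "m = Suc (Suc n)"
    by (metis One_nat_def not0_implies_Suc)
  then show ?case
  proof cases
    case 1
    then show ?thesis
      using less.prems filt_zero[of 0] by (intro bexI[of _ r]) auto
  next
    case 2
    obtain p p' where *: "p \<in> B" "p' \<in> B" "u * r = p * u + p'"
      using left_to_right[of u r] less.prems by blast
    then show ?thesis
      using word_filt[of 0 1 p'] 2 by (intro bexI[of _ p]) auto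
  next
    case 3
    obtain r' where r': "r' \<in> B" "E n * r - r' * E n \<in> filt n"
      using less.IH[of n r] less.prems 3 by auto
    obtain p p' where *: "p \<in> B" "p' \<in> B" "c n * r' = p * c n + p'"
      using left_to_right[OF letters(1) r'(1)] by blast
    have "E m * r - p * E m = c n * (E n * r - r' * E n) + (c n * r') * E n - p * E m"
      using 3 by (simp add: algebra_simps)
    also have "\<dots> = c n * (E n * r - r' * E n) + p' * E n"
      unfolding *(3) using 3 by (simp add: algebra_simps)
    finally have eq: "E m * r - p * E m = c n * (E n * r - r' * E n) + p' * E n" .
    have "c n * (E n * r - r' * E n) \<in> filt m"
      using letter_filt[OF letters(1) r'(2)] 3 by simp
    moreover have "p' * E n \<in> filt m"
      using filt_mono[OF _ left_word[OF *(2)], of n m] 3 by simp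
    ultimately show ?thesis
      using eq filt_add *(1) by metis
  qed
qed

text \<open>
  The union of the spans is closed under left multiplication by coefficients and by letters, hence
  under multiplication by words, and hence is a ring.
\<close>

lemma subring_gen_eq_filt: "subring_gen (S \<union> {u, v}) = (\<Union>m. filt m)"
proof
  let ?A = "\<Union>m. filt m"
  have add: "x + y \<in> ?A" and diff: "x - y \<in> ?A" if xy: "x \<in> ?A" "y \<in> ?A" for x y
  proof -
    obtain m n where mn: "x \<in> filt m" "y \<in> filt n"
      using xy by blast
    then have "x \<in> filt (max m n)" "y \<in> filt (max m n)"
      using filt_mono[of m "max m n"] filt_mono[of n "max m n"] by auto
    then show "x + y \<in> ?A" "x - y \<in> ?A"
      by (blast intro: filt_add filt_diff)+
  qed
  have letter: "z * x \<in> ?A" if "z \<in> {u, v}" "x \<in> ?A" for z x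
    using letter_filt that by blast
  have word: "E m * x \<in> ?A" if "x \<in> ?A" for m x
    using that
  proof (induction m arbitrary: x rule: less_induct)
    case (less m)
    consider "m = 0" | "m = 1" | n where "m = Suc (Suc n)"
      by (metis One_nat_def not0_implies_Suc)
    then show ?case
    proof cases
      case 1
      then show ?thesis using less.prems by simp
    next
      case 2
      then show ?thesis using less.prems letter[of u x] by simp
    next
      case 3
      then show ?thesis
        using less.IH[of n x] less.prems letter[OF letters(1), of "E n * x" n]
        by (simp add: mult.assoc)
    qed
  qed
  have mult: "x * y \<in> ?A" if "x \<in> filt m" "y \<in> ?A" for x y m
    using that
  proof (induction m arbitrary: x)
    case 0
    then have "x * y \<in> filt 0" using J_right by simp
    then show ?case by blast
  next
    case (Suc m)
    then obtain p g where g: "x = E m * p + g" "p \<in> B" "g \<in> filt m"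
      by (auto elim: filtE)
    have "E m * (p * y) \<in> ?A"
      using word filt_left[OF g(2)] Suc.prems(2) by blast
    then show ?case
      using add Suc.IH[OF g(3) Suc.prems(2)] g(1) by (simp add: algebra_simps)
  qed
  show "subring_gen (S \<union> {u, v}) \<subseteq> ?A"
  proof
    fix x assume "x \<in> subring_gen (S \<union> {u, v})"
    then show "x \<in> ?A"
    proof induction
      case (ideal x)
      then show ?case using ideal_filt by blast
    next
      case (generator x)
      then show ?case
        using word_filt[of 0 1 x] letter_unit[of x] by (auto intro: subring_gen.intros)
    next
      case one
      then show ?case using word_in_filt[of 0 1] by auto
    next
      case (diff x y)
      then show ?case using \<open>\<And>y x. x \<in> ?A \<Longrightarrow> y \<in> ?A \<Longrightarrow> x - y \<in> ?A\<close> by blast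
    next
      case (mult x y)
      then show ?case using \<open>\<And>y x m. x \<in> filt m \<Longrightarrow> y \<in> ?A \<Longrightarrow> x * y \<in> ?A\<close> by blast
    qed
  qed
  have B_sub: "p \<in> subring_gen (S \<union> {u, v})" if "p \<in> B" for p
    using subring_gen_mono[OF _ that] by blast
  have "u \<in> subring_gen (S \<union> {u, v})" "v \<in> subring_gen (S \<union> {u, v})"
    by (auto intro: subring_gen.intros)
  then have letter_in: "c m \<in> subring_gen (S \<union> {u, v})" "u \<in> subring_gen (S \<union> {u, v})" for m
    using letters(1)[of m] by auto
  have E_in: "E m \<in> subring_gen (S \<union> {u, v})" for m
    by (induction m rule: induct_nat_012)
       (use letter_in in \<open>auto intro: subring_gen.one subring_gen.mult\<close>)
  have "x \<in> subring_gen (S \<union> {u, v})" if "x \<in> filt m" for x m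
    using that
  proof (induction m arbitrary: x)
    case 0
    then show ?case by (auto intro: subring_gen.intros)
  next
    case (Suc m)
    then show ?case
      using B_sub E_in by (auto elim!: filtE intro!: subring_gen_add subring_gen.mult)
  qed
  then show "?A \<subseteq> subring_gen (S \<union> {u, v})"
    by blast
qed

theorem left_noetherian_extension:
  assumes "left_noetherian_gen S"
  shows "left_noetherian_gen (S \<union> {u, v})"
proof (rule left_acc_filtered[where B = B and E = E and G = filt and c = c and d = 2])
  show "left_acc J B" by (rule assms)
  show "left_submodule B B" "left_submodule B (filt m)" for m
    unfolding left_submodule_def
    using subring_gen_additive filt_additive filt_left by (auto intro: subring_gen.intros)
  show "J \<subseteq> B" by (auto intro: subring_gen.intros)
  show "B \<subseteq> subring_gen (S \<union> {u, v})"
    using subring_gen_mono by blast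
  show "\<exists>p\<in>B. x - E m * p \<in> filt m" if x: "x \<in> filt (Suc m)" for x m
  proof -
    obtain p g where "x = E m * p + g" "p \<in> B" "g \<in> filt m"
      using x by (rule filtE)
    then show ?thesis
      by (intro bexI[of _ p]) auto
  qed
  show "c m \<in> subring_gen (S \<union> {u, v})" for m
    using letters(1)[of m] by (auto intro: subring_gen.intros)
  show "c m * g \<in> filt (m + 2)" if "g \<in> filt m" for m g
    using letter_filt[OF letters(1) that] by simp
  show "subring_gen (S \<union> {u, v}) = (\<Union>m. filt m)"
    by (rule subring_gen_eq_filt)
qed (simp_all add: J_left filt_right ideal_filt word_normal)

end

section \<open>Scalars, Laurent extensions and dihedral extensions\<close>

context two_sided_ideal
begin

lemma subring_gen_scalars:
  assumes K: "additive_set K" "1 \<in> K" "\<And>k l. k \<in> K \<Longrightarrow> l \<in> K \<Longrightarrow> k * l \<in> K"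
    and "x \<in> subring_gen K"
  shows "\<exists>k\<in>K. x \<doteq> k"
  using assms(4)
proof induction
  case (ideal x)
  then show ?case
    using additive_set_zero[OF K(1)] by (intro bexI[of _ 0]) (auto simp: cong_def)
next
  case (diff x y)
  then show ?case
    using cong_diff additive_set_diff[OF K(1)] by blast
next
  case (mult x y)
  then show ?case
    using cong_mult K(3) by blast
qed (use K(2) in \<open>auto intro: cong_refl\<close>)

text \<open>Modulo \<open>J\<close> the scalars form a skew field or the zero ring, which has at most two left ideals.\<close>

lemma left_noetherian_scalars:
  assumes K: "additive_set K" "1 \<in> K" "\<And>k l. k \<in> K \<Longrightarrow> l \<in> K \<Longrightarrow> k * l \<in> K"
    and inverse: "\<And>k. k \<in> K \<Longrightarrow> k \<noteq> 0 \<Longrightarrow> \<exists>k'\<in>K. k' * k = 1"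
  shows "left_noetherian_gen K"
proof -
  have trivial: "N = J \<or> N = subring_gen K"
    if N: "left_submodule (subring_gen K) N" "J \<subseteq> N" "N \<subseteq> subring_gen K" for N
  proof (cases "N = J")
    case False
    then obtain x where x: "x \<in> N" "x \<notin> J"
      using N(2) by blast
    then obtain k where k: "k \<in> K" "x \<doteq> k"
      using subring_gen_scalars[OF K] N(3) by blast
    then have "k \<noteq> 0"
      using x(2) by (auto simp: cong_def)
    then obtain k' where k': "k' \<in> K" "k' * k = 1"
      using inverse k(1) by blast
    have "k' * x \<in> N"
      using left_submodule_mult[OF N(1) _ x(1)] k'(1) by (simp add: subring_gen.generator)
    moreover have "k' * x - 1 \<in> N"
      using cong_left[OF k(2), of k'] N(2) by (auto simp: k'(2) cong_def)
    ultimately have "1 \<in> N"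
      using additive_set_diff[OF left_submodule_additive[OF N(1)], of "k' * x" "k' * x - 1"] by simp
    then have "y \<in> N" if "y \<in> subring_gen K" for y
      using left_submodule_mult[OF N(1) that, of 1] by simp
    then show ?thesis
      using N(3) by blast
  qed simp
  show ?thesis
    unfolding left_acc_def
  proof (intro allI impI, elim conjE)
    fix f :: "nat \<Rightarrow> 'a set"
    assume f: "\<forall>n. left_submodule (subring_gen K) (f n) \<and> J \<subseteq> f n \<and> f n \<subseteq> subring_gen K" "incseq f"
    show "\<exists>N. \<forall>n\<ge>N. f n = f N"
    proof (cases "\<exists>N. f N \<noteq> J")
      case True
      then obtain N where "f N = subring_gen K"
        using trivial f(1) by blast
      then have "\<forall>n\<ge>N. f n = f N"
        using f by (metis incseq_def subset_antisym)
      then show ?thesis by blast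
    qed simp
  qed
qed

text \<open>
  The two ends are the positive powers of \<open>x\<close> and the positive powers of its inverse \<open>y\<close>; they cancel when they meet.
\<close>

lemma left_noetherian_laurent:
  assumes "left_noetherian_gen S" and inv: "x * y \<doteq> 1" "y * x \<doteq> 1"
    and conj: "\<And>r. r \<in> S \<Longrightarrow> x * r * y \<in> subring_gen S" "\<And>r. r \<in> S \<Longrightarrow> y * r * x \<in> subring_gen S"
  shows "left_noetherian_gen (S \<union> {x, y})"
proof -
  have left: "moves_left S x' r" if "x' * y' \<doteq> 1" "y' * x' \<doteq> 1" "x' * r * y' \<in> subring_gen S" for x' y' r
    using cong_sym[OF cong_left[OF that(2), of "x' * r"]] that(3) subring_gen_zero
    by (intro moves_leftI[where p = "x' * r * y'" and p' = 0]) (auto simp: mult.assoc)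
  have right: "moves_right S x' r" if "x' * y' \<doteq> 1" "y' * x' \<doteq> 1" "y' * r * x' \<in> subring_gen S" for x' y' r
    using cong_sym[OF cong_right[OF that(1), of "r * x'"]] that(3) subring_gen_zero
    by (intro moves_rightI[where p = "y' * r * x'" and p' = 0]) (auto simp: mult.assoc)
  have one: "\<exists>p\<in>subring_gen S. \<exists>p'\<in>subring_gen S. z * w = p * w + p'" if "z * w \<doteq> 1" for z w
    using subring_gen_zero[of S] subring_gen_cong[OF that subring_gen.one, of S]
    by (intro bexI[of _ 0] bexI[of _ "z * w"]) auto
  interpret two_ended_extension J S x y "\<lambda>m. if even m then y else x"
  proof
    show "moves_left S z r \<and> moves_right S z r" if "z \<in> {x, y}" "r \<in> S" for z r
      using that left right inv conj by blast
  next
    fix z :: 'a and j :: nat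
    assume "z \<in> {x, y}"
    then show "z = (if even (Suc (Suc j)) then y else x) \<or>
      (\<exists>p\<in>subring_gen S. \<exists>p'\<in>subring_gen S.
        z * (if even j then y else x) = p * (if even j then y else x) + p')"
      using one inv by auto
  qed (use one[OF inv(2)] in auto)
  show ?thesis
    using left_noetherian_extension assms(1) .
qed

text \<open>
  The words are \<open>1, a, b, b a, a b, a b a, b a b, \<dots>\<close>. A letter either continues a word or repeats
  its first letter, and then the quadratic relation shortens the product. Since the two words of
  each length need different letters, the continuing letter runs through \<open>b, b, a, a\<close> periodically.
\<close>

lemma left_noetherian_dihedral:
  assumes "left_noetherian_gen S"
    and quadratic: "a * a \<doteq> \<gamma> * a + 1" "b * b \<doteq> \<gamma> * b + 1" and "\<gamma> \<in> subring_gen S"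
    and moves: "\<And>r. r \<in> S \<Longrightarrow> moves_left S a r" "\<And>r. r \<in> S \<Longrightarrow> moves_right S a r"
      "\<And>r. r \<in> S \<Longrightarrow> moves_left S b r" "\<And>r. r \<in> S \<Longrightarrow> moves_right S b r"
  shows "left_noetherian_gen (S \<union> {a, b})"
proof -
  have square: "\<exists>p\<in>subring_gen S. \<exists>p'\<in>subring_gen S. z * z = p * z + p'" if "z \<in> {a, b}" for z
    using moves_leftI[of z z \<gamma> 1 S] quadratic assms(4) subring_gen.one that
    unfolding moves_left_def by blast
  interpret two_ended_extension J S a b "\<lambda>m. if m mod 4 < 2 then b else a"
  proof
    show "moves_left S z r \<and> moves_right S z r" if "z \<in> {a, b}" "r \<in> S" for z r
      using that moves by blast
  next
    fix z :: 'a and j :: nat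
    assume z: "z \<in> {a, b}"
    have "(Suc (Suc j) mod 4 < 2) = (\<not> j mod 4 < 2)"
      by presburger
    then show "z = (if Suc (Suc j) mod 4 < 2 then b else a) \<or>
      (\<exists>p\<in>subring_gen S. \<exists>p'\<in>subring_gen S.
        z * (if j mod 4 < 2 then b else a) = p * (if j mod 4 < 2 then b else a) + p')"
      using square z by auto
  qed (use square in auto)
  show ?thesis
    using left_noetherian_extension assms(1) .
qed

text \<open>
  The quadratic relation makes \<open>Z - \<gamma>\<close> inverse to \<open>Z\<close>, so \<open>Z M Z = N\<close> reads \<open>Z M = N (Z - \<gamma>)\<close>
  and \<open>M Z = (Z - \<gamma>) N\<close>. The proof gets the same equations by evaluating \<open>Z M Z\<^sup>2\<close> and \<open>Z\<^sup>2 M Z\<close> in two ways.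
\<close>

lemma quadratic_braid:
  assumes quadratic: "Z * Z \<doteq> \<gamma> * Z + 1" and braid: "Z * M * Z \<doteq> N"
    and central: "\<And>x. \<gamma> * x = x * \<gamma>"
    and S: "\<gamma> \<in> subring_gen S" "M \<in> subring_gen S" "N \<in> subring_gen S"
  shows "moves_left S Z M" "moves_left S Z N" "moves_right S Z M" "moves_right S Z N"
proof -
  have "N * Z \<doteq> Z * M * (Z * Z)"
    using cong_right[OF cong_sym[OF braid], of Z] by (simp add: mult.assoc)
  also have "\<dots> \<doteq> Z * M * (\<gamma> * Z + 1)"
    by (rule cong_left[OF quadratic])
  also have "\<dots> = \<gamma> * (Z * M * Z) + Z * M"
    by (metis (no_types, opaque_lifting) central distrib_left mult.assoc mult.right_neutral)
  also have "\<dots> \<doteq> \<gamma> * N + Z * M"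
    by (intro cong_add cong_left braid cong_refl)
  finally have NZ: "N * Z \<doteq> \<gamma> * N + Z * M" .
  have "Z * N \<doteq> (Z * Z) * (M * Z)"
    using cong_left[OF cong_sym[OF braid], of Z] by (simp add: mult.assoc)
  also have "\<dots> \<doteq> (\<gamma> * Z + 1) * (M * Z)"
    by (rule cong_right[OF quadratic])
  also have "\<dots> = \<gamma> * (Z * M * Z) + M * Z"
    by (simp add: algebra_simps)
  also have "\<dots> \<doteq> \<gamma> * N + M * Z"
    by (intro cong_add cong_left braid cong_refl)
  finally have ZN: "Z * N \<doteq> \<gamma> * N + M * Z" .
  have \<gamma>N: "\<gamma> * N \<in> subring_gen S" "- (\<gamma> * N) \<in> subring_gen S"
    using subring_gen.mult[OF S(1,3)] subring_gen_uminus by auto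
  show "moves_left S Z M"
    by (rule moves_leftI[OF _ S(3) \<gamma>N(2)])
       (use cong_sym[OF NZ] in \<open>simp add: cong_def algebra_simps\<close>)
  show "moves_left S Z N"
    by (rule moves_leftI[OF _ S(2) \<gamma>N(1)]) (use ZN in \<open>simp add: add.commute\<close>)
  show "moves_right S Z N"
    by (rule moves_rightI[OF _ S(2) \<gamma>N(1)]) (use NZ in \<open>simp add: add.commute\<close>)
  show "moves_right S Z M"
    by (rule moves_rightI[OF _ S(3) \<gamma>N(2)])
       (use cong_sym[OF ZN] in \<open>simp add: cong_def algebra_simps\<close>)
qed

text \<open>Inverting both sides of \<open>Z M Z = N\<close> and then clearing the inverses of \<open>Z\<close>.\<close>

lemma quadratic_braid_inverse:
  assumes quadratic: "Z * Z \<doteq> \<gamma> * Z + 1" and braid: "Z * M * Z \<doteq> N"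
    and central: "\<And>x. \<gamma> * x = x * \<gamma>" and inv: "M' * M \<doteq> 1" "N * N' \<doteq> 1"
  shows "Z * N' * Z \<doteq> M'"
proof -
  define W where "W = Z - \<gamma>"
  have WZ: "W * Z \<doteq> 1" and ZW: "Z * W \<doteq> 1"
    using quadratic by (simp_all add: W_def cong_def algebra_simps central)
  have "M * Z * N' \<doteq> W * Z * (M * Z * N')"
    using cong_right[OF cong_sym[OF WZ], of "M * Z * N'"] by simp
  also have "\<dots> \<doteq> W * (N * N')"
    using cong_mid[OF braid, of W N'] by (simp add: mult.assoc)
  also have "\<dots> \<doteq> W"
    using cong_left[OF inv(2), of W] by simp
  finally have MZN': "M * Z * N' \<doteq> W" .
  have "Z * N' * Z \<doteq> M' * M * (Z * N' * Z)"
    using cong_right[OF cong_sym[OF inv(1)], of "Z * N' * Z"] by simp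
  also have "\<dots> \<doteq> M' * W * Z"
    using cong_mid[OF MZN', of M' Z] by (simp add: mult.assoc)
  also have "\<dots> \<doteq> M'"
    using cong_left[OF WZ, of M'] by (simp add: mult.assoc)
  finally show ?thesis .
qed

end

section \<open>A presentation that is symmetric under reversal\<close>

text \<open>
  Here \<open>P\<close> stands for \<open>Y\<^sub>2 T\<close> and \<open>P'\<close> for its inverse. Reversing all products and exchanging \<open>P\<close> with
  \<open>P'\<close> turns each assumption into an assumption or a consequence of them, which the original
  relations in \<open>Y\<^sub>1\<close> and \<open>Y\<^sub>2\<close> do not show.
\<close>

locale daha_presentation = two_sided_ideal J for J :: "'a::ring_1 set" +
  fixes K :: "'a set" and q q' \<gamma> T X1 X1' X2 X2' P P' :: 'a
  assumes scalars: "additive_set K" "1 \<in> K" "\<And>k l. k \<in> K \<Longrightarrow> l \<in> K \<Longrightarrow> k * l \<in> K"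
    and scalar_inverse: "\<And>k. k \<in> K \<Longrightarrow> k \<noteq> 0 \<Longrightarrow> \<exists>k'\<in>K. k' * k = 1"
    and central: "\<And>k x. k \<in> K \<Longrightarrow> k * x = x * k"
    and parameters: "q \<in> K" "q' \<in> K" "q * q' = 1" "\<gamma> \<in> K"
    and X1_inv: "X1 * X1' \<doteq> 1" "X1' * X1 \<doteq> 1"
    and X2_inv: "X2 * X2' \<doteq> 1" "X2' * X2 \<doteq> 1"
    and X_commute: "X1 * X2 \<doteq> X2 * X1"
    and quadratic: "T * T \<doteq> \<gamma> * T + 1"
    and braid: "T * X1 * T \<doteq> X2"
    and P_inv: "P * P' \<doteq> 1" "P' * P \<doteq> 1"
    and P_X1: "P' * X1 * P \<doteq> X2"
    and P_X2: "P' * X2 * P \<doteq> q' * X1"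
    and P_T: "P * P * T \<doteq> T * P * P"
    and generated: "subring_gen (K \<union> {X1, X1', X2, X2', T, P, P'}) = UNIV"
begin

lemma q'_q: "q' * q = 1"
  using central[OF parameters(1), of q'] parameters(3) by simp

lemma scaled_inverse:
  assumes "k \<in> K" "k' * k = 1" "x' * x \<doteq> 1"
  shows "(k' * x') * (k * x) \<doteq> 1"
proof -
  have "(k' * x') * (k * x) = (k' * k) * (x' * x)"
    using central[OF assms(1), of x'] by (metis mult.assoc)
  then show ?thesis
    using assms(2,3) by simp
qed

lemma scalar_conj:
  assumes "k \<in> K" "z * z' \<doteq> 1"
  shows "z * k * z' \<doteq> k"
  using cong_left[OF assms(2), of k] central[OF assms(1), of z] by (simp flip: mult.assoc)

lemma scalar_moves:
  assumes "k \<in> K" "K \<subseteq> S"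
  shows "moves_left S z k" "moves_right S z k"
  using assms central[OF assms(1), of z] subring_gen_zero
  by (auto intro!: moves_leftI[of z k k 0] moves_rightI[of k z k 0] intro: subring_gen.generator)

abbreviation "SX \<equiv> K \<union> {X1, X1'} \<union> {X2, X2'}"

lemma left_noetherian_X: "left_noetherian_gen SX"
proof (rule left_noetherian_laurent[OF left_noetherian_laurent[OF left_noetherian_scalars]])
  let ?S = "K \<union> {X1, X1'}"
  have *: "z * X1 * z' \<doteq> X1" if "z * X1 \<doteq> X1 * z" "z * z' \<doteq> 1" for z z'
  proof -
    have "z * X1 * z' \<doteq> X1 * (z * z')"
      using cong_right[OF that(1), of z'] by (simp add: mult.assoc)
    also have "\<dots> \<doteq> X1"
      using cong_left[OF that(2), of X1] by simp
    finally show ?thesis .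
  qed
  have X2: "X2 * X1 * X2' \<doteq> X1"
    using * cong_sym[OF X_commute] X2_inv by blast
  have X2': "X2' * X1 * X2 \<doteq> X1"
    by (rule conjugate_swap[OF X2 X2_inv(2)])
  have gen: "x \<in> subring_gen ?S" if "x \<in> ?S" for x
    using that by (rule subring_gen.generator)
  show "X2 * r * X2' \<in> subring_gen ?S" if "r \<in> ?S" for r
    using that subring_gen_cong[OF X2] subring_gen_cong[OF scalar_conj[OF _ X2_inv(1)]]
      subring_gen_cong[OF conjugate_inverse[OF X2 X2_inv(2,1) X1_inv]] gen by blast
  show "X2' * r * X2 \<in> subring_gen ?S" if "r \<in> ?S" for r
    using that subring_gen_cong[OF X2'] subring_gen_cong[OF scalar_conj[OF _ X2_inv(2)]]
      subring_gen_cong[OF conjugate_inverse[OF X2' X2_inv(1,2) X1_inv]] gen by blast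
  show "X1 * r * X1' \<in> subring_gen K" "X1' * r * X1 \<in> subring_gen K" if r: "r \<in> K" for r
    using subring_gen_cong[OF scalar_conj[OF r X1_inv(1)] subring_gen.generator[OF r]]
      subring_gen_cong[OF scalar_conj[OF r X1_inv(2)] subring_gen.generator[OF r]] .
qed (use scalars scalar_inverse X1_inv X2_inv in auto)

text \<open>The affine generator of the Hecke algebra of the infinite dihedral group.\<close>

definition "T0 = P * T * P'"

text \<open>Since \<open>P\<^sup>2\<close> commutes with \<open>T\<close>, conjugating \<open>T\<close> by \<open>P\<close> or by its inverse gives the same element.\<close>

lemma P'_T: "P' * T * P \<doteq> T0"
proof -
  have "P' * T * P \<doteq> P' * (T * P * P) * P'"
    using cong_left[OF cong_sym[OF P_inv(1)], of "P' * T * P"] by (simp add: mult.assoc)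
  also have "\<dots> \<doteq> P' * (P * P * T) * P'"
    by (rule cong_mid[OF cong_sym[OF P_T]])
  also have "\<dots> \<doteq> P * T * P'"
    using cong_right[OF P_inv(2), of "P * T * P'"] by (simp add: mult.assoc)
  finally show ?thesis by (simp add: T0_def)
qed

lemma T_conj:
  shows P'_T0: "P' * T0 * P \<doteq> T" and P_T0: "P * T0 * P' \<doteq> T"
  using conjugate_swap[OF P'_T P_inv(1)] conjugate_swap[of P T P' T0] P_inv(2)
  by (auto simp: T0_def)

lemma P_conj_X: "P * X2 * P' \<doteq> X1" "P * X1 * P' \<doteq> q * X2"
proof -
  show "P * X2 * P' \<doteq> X1"
    by (rule conjugate_swap[OF P_X1 P_inv(1)])
  have "P * (q' * X1) * P' \<doteq> X2"
    by (rule conjugate_swap[OF P_X2 P_inv(1)])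
  then have "q * (P * (q' * X1) * P') \<doteq> q * X2"
    by (rule cong_left)
  moreover have "q * (P * (q' * X1) * P') = (q * q') * (P * X1 * P')"
    using central[OF parameters(2), of P] by (metis mult.assoc)
  ultimately show "P * X1 * P' \<doteq> q * X2"
    using parameters(3) by simp
qed

lemma quadratic_T0: "T0 * T0 \<doteq> \<gamma> * T0 + 1"
proof -
  have "T0 * T0 \<doteq> P * (T * T) * P'"
    using cong_mid[OF P_inv(2), of "P * T" "T * P'"] by (simp add: T0_def mult.assoc)
  also have "\<dots> \<doteq> P * (\<gamma> * T + 1) * P'"
    by (rule cong_mid[OF quadratic])
  also have "\<dots> = \<gamma> * T0 + P * P'"
    using central[OF parameters(4), of P] by (simp add: T0_def algebra_simps flip: mult.assoc)
  also have "\<dots> \<doteq> \<gamma> * T0 + 1"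
    by (intro cong_add cong_refl P_inv)
  finally show ?thesis .
qed

text \<open>The relation \<open>T X\<^sub>1 T = X\<^sub>2\<close>, conjugated by \<open>P\<close>.\<close>

lemma braid_T0: "T0 * (q * X2) * T0 \<doteq> X1"
proof -
  have "T0 * (q * X2) * T0 \<doteq> T0 * (P * X1 * P') * T0"
    by (rule cong_mid[OF cong_sym[OF P_conj_X(2)]])
  also have "\<dots> \<doteq> P * T * X1 * P' * T0"
    using cong_mid[OF P_inv(2), of "P * T" "X1 * P' * T0"] by (simp add: T0_def mult.assoc)
  also have "\<dots> \<doteq> P * (T * X1 * T) * P'"
    using cong_mid[OF P_inv(2), of "P * T * X1" "T * P'"] by (simp add: T0_def mult.assoc)
  also have "\<dots> \<doteq> P * X2 * P'"
    by (rule cong_mid[OF braid])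
  also have "\<dots> \<doteq> X1"
    by (rule P_conj_X)
  finally show ?thesis .
qed

lemma X_in: "X1 \<in> subring_gen SX" "X1' \<in> subring_gen SX" "X2 \<in> subring_gen SX" "X2' \<in> subring_gen SX"
  "k \<in> K \<Longrightarrow> k \<in> subring_gen SX"
  by (auto intro: subring_gen.generator)

text \<open>
  The braid relation of \<open>T0\<close> involves \<open>q * X2\<close> and, after inversion, \<open>q' * X2'\<close>; the next two
  lemmas remove the scalar.
\<close>

lemma moves_left_unscale:
  assumes "k \<in> K" "k' \<in> K" "k' * k = 1" "moves_left SX z (k * r)"
  shows "moves_left SX z r"
proof -
  obtain p p' where *: "p \<in> subring_gen SX" "p' \<in> subring_gen SX" "z * (k * r) = p * z + p'"
    using assms(4) by (auto simp: moves_left_def)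
  have "z * r = k' * (z * (k * r))"
    using central[OF assms(1), of z] assms(3) by (metis mult.assoc mult_1)
  also have "\<dots> = (k' * p) * z + k' * p'"
    by (simp add: *(3) algebra_simps)
  finally show ?thesis
    using * X_in(5)[OF assms(2)] unfolding moves_left_def by (blast intro: subring_gen.mult)
qed

lemma moves_right_unscale:
  assumes "k \<in> K" "k' \<in> K" "k' * k = 1" "moves_right SX z (k * r)"
  shows "moves_right SX z r"
proof -
  obtain p p' where *: "p \<in> subring_gen SX" "p' \<in> subring_gen SX" "k * r * z = z * p + p'"
    using assms(4) by (auto simp: moves_right_def)
  have "r * z = k' * (k * r * z)"
    using assms(3) by (metis mult.assoc mult_1)
  also have "\<dots> = z * (k' * p) + k' * p'"
    unfolding *(3) using central[OF assms(2), of z] by (metis distrib_left mult.assoc)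
  finally show ?thesis
    using * X_in(5)[OF assms(2)] unfolding moves_right_def by (blast intro: subring_gen.mult)
qed

abbreviation "ST \<equiv> SX \<union> {T0, T}"

lemma left_noetherian_T: "left_noetherian_gen ST"
proof (rule left_noetherian_dihedral[OF left_noetherian_X quadratic_T0 quadratic])
  note \<gamma> = X_in(5)[OF parameters(4)] and q = X_in(5)[OF parameters(1)] and q' = X_in(5)[OF parameters(2)]
  note central_\<gamma> = central[OF parameters(4)]
  note T = quadratic_braid[OF quadratic braid central_\<gamma> \<gamma> X_in(1,3)]
    quadratic_braid[OF quadratic quadratic_braid_inverse[OF quadratic braid central_\<gamma> X1_inv(2) X2_inv(1)]
        central_\<gamma> \<gamma> X_in(4,2)]
  have inv: "(q' * X2') * (q * X2) \<doteq> 1"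
    by (rule scaled_inverse[OF parameters(1) q'_q X2_inv(2)])
  note T0 = quadratic_braid[OF quadratic_T0 braid_T0 central_\<gamma> \<gamma> subring_gen.mult[OF q X_in(3)] X_in(1)]
    quadratic_braid[OF quadratic_T0 quadratic_braid_inverse[OF quadratic_T0 braid_T0 central_\<gamma> inv X1_inv(1)]
        central_\<gamma> \<gamma> X_in(2) subring_gen.mult[OF q' X_in(4)]]
  note unscale = moves_left_unscale[OF parameters(1,2) q'_q] moves_right_unscale[OF parameters(1,2) q'_q]
    moves_left_unscale[OF parameters(2,1,3)] moves_right_unscale[OF parameters(2,1,3)]
  have K: "K \<subseteq> SX" by blast
  show "moves_left SX T0 r" "moves_right SX T0 r" "moves_left SX T r" "moves_right SX T r" if "r \<in> SX" for r
    using that T T0 unscale scalar_moves[OF _ K] by blast+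
  show "\<gamma> \<in> subring_gen SX" by (rule \<gamma>)
qed

lemma left_noetherian: "left_acc J UNIV"
proof -
  have in_ST: "x \<in> subring_gen ST" if "x \<in> ST" for x
    using that by (rule subring_gen.generator)
  have q_in: "q \<in> subring_gen ST" "q' \<in> subring_gen ST"
    using parameters in_ST by auto
  have inv_q: "(q' * X2') * (q * X2) \<doteq> 1" "(q * X1') * (q' * X1) \<doteq> 1"
    by (rule scaled_inverse[OF parameters(1) q'_q X2_inv(2)],
        rule scaled_inverse[OF parameters(2,3) X1_inv(2)])
  have P: "P * r * P' \<in> subring_gen ST" if "r \<in> ST" for r
  proof -
    have "P * X1 * P' \<in> subring_gen ST"
      by (rule subring_gen_cong[OF P_conj_X(2)]) (rule subring_gen.mult[OF q_in(1) in_ST], simp)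
    moreover have "P * X1' * P' \<in> subring_gen ST"
      by (rule subring_gen_cong[OF conjugate_inverse[OF P_conj_X(2) P_inv(2,1) X1_inv(1) inv_q(1)]])
         (rule subring_gen.mult[OF q_in(2) in_ST], simp)
    moreover have "P * X2 * P' \<in> subring_gen ST"
      by (rule subring_gen_cong[OF P_conj_X(1)]) (rule in_ST, simp)
    moreover have "P * X2' * P' \<in> subring_gen ST"
      by (rule subring_gen_cong[OF conjugate_inverse[OF P_conj_X(1) P_inv(2,1) X2_inv(1) X1_inv(2)]])
         (rule in_ST, simp)
    moreover have "P * T * P' \<in> subring_gen ST"
      using in_ST by (auto simp: T0_def)
    moreover have "P * T0 * P' \<in> subring_gen ST"
      by (rule subring_gen_cong[OF P_T0]) (rule in_ST, simp)
    moreover have "P * k * P' \<in> subring_gen ST" if "k \<in> K" for k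
      by (rule subring_gen_cong[OF scalar_conj[OF that P_inv(1)]]) (use that in \<open>intro in_ST, simp\<close>)
    ultimately show ?thesis
      using that by blast
  qed
  have P': "P' * r * P \<in> subring_gen ST" if "r \<in> ST" for r
  proof -
    have "P' * X1 * P \<in> subring_gen ST"
      by (rule subring_gen_cong[OF P_X1]) (rule in_ST, simp)
    moreover have "P' * X1' * P \<in> subring_gen ST"
      by (rule subring_gen_cong[OF conjugate_inverse[OF P_X1 P_inv(1,2) X1_inv(1) X2_inv(2)]])
         (rule in_ST, simp)
    moreover have "P' * X2 * P \<in> subring_gen ST"
      by (rule subring_gen_cong[OF P_X2]) (rule subring_gen.mult[OF q_in(2) in_ST], simp)
    moreover have "P' * X2' * P \<in> subring_gen ST"
      by (rule subring_gen_cong[OF conjugate_inverse[OF P_X2 P_inv(1,2) X2_inv(1) inv_q(2)]])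
         (rule subring_gen.mult[OF q_in(1) in_ST], simp)
    moreover have "P' * T * P \<in> subring_gen ST"
      by (rule subring_gen_cong[OF P'_T]) (rule in_ST, simp)
    moreover have "P' * T0 * P \<in> subring_gen ST"
      by (rule subring_gen_cong[OF P'_T0]) (rule in_ST, simp)
    moreover have "P' * k * P \<in> subring_gen ST" if "k \<in> K" for k
      by (rule subring_gen_cong[OF scalar_conj[OF that P_inv(2)]]) (use that in \<open>intro in_ST, simp\<close>)
    ultimately show ?thesis
      using that by blast
  qed
  have "left_noetherian_gen (ST \<union> {P, P'})"
    by (rule left_noetherian_laurent[OF left_noetherian_T P_inv P P'])
  moreover have "subring_gen (ST \<union> {P, P'}) = UNIV"
    using subring_gen_mono[of "K \<union> {X1, X1', X2, X2', T, P, P'}" "ST \<union> {P, P'}"] generated by auto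
  ultimately show ?thesis
    by simp
qed

end

section \<open>The opposite ring\<close>

text \<open>
  With reversed multiplication on a copy of the type, right ideals become left submodules, and every
  result above applies to them.
\<close>

datatype 'a opposite = Opposite (unopposite: 'a)

instantiation opposite :: (ring_1) ring_1
begin

definition "0 = Opposite 0"
definition "1 = Opposite 1"
definition "x + y = Opposite (unopposite x + unopposite y)"
definition "x - y = Opposite (unopposite x - unopposite y)"
definition "- x = Opposite (- unopposite x)"
definition "x * y = Opposite (unopposite y * unopposite x)"

instance
  by standard
    (auto simp: zero_opposite_def one_opposite_def plus_opposite_def minus_opposite_def
       uminus_opposite_def times_opposite_def algebra_simps intro: opposite.expand)

end

lemmas opposite_defs = zero_opposite_def one_opposite_def plus_opposite_def minus_opposite_def
  uminus_opposite_def times_opposite_def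

lemma additive_set_Opposite: "additive_set (Opposite ` A) \<longleftrightarrow> additive_set A"
  unfolding additive_set_def by (auto simp: opposite_defs)

lemma two_sided_ideal_Opposite:
  assumes "two_sided_ideal J"
  shows "two_sided_ideal (Opposite ` J)"
proof -
  interpret two_sided_ideal J by fact
  show ?thesis
    by standard (auto simp: additive_set_Opposite J_additive opposite_defs J_left J_right)
qed

context daha_presentation
begin

theorem right_noetherian: "left_acc (Opposite ` J) UNIV"
proof -
  interpret op: two_sided_ideal "Opposite ` J"
    by (rule two_sided_ideal_Opposite) (rule two_sided_ideal_axioms)
  have cong: "op.cong (Opposite x) (Opposite y) \<longleftrightarrow> x \<doteq> y" for x y
    by (auto simp: op.cong_def cong_def opposite_defs)
  have P'_P'_T: "T * P' * P' \<doteq> P' * P' * T"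
  proof -
    have PP: "P * P * (P' * P') \<doteq> 1" "(P' * P') * (P * P) \<doteq> 1"
      using cong_trans[OF cong_mid[OF P_inv(1), of P P'] _] cong_trans[OF cong_mid[OF P_inv(2), of P' P] _] P_inv
      by (auto simp: mult.assoc)
    have "T * P' * P' \<doteq> (P' * P') * (P * P * T) * (P' * P')"
      using cong_right[OF cong_sym[OF PP(2)], of "T * P' * P'"] by (simp add: mult.assoc)
    also have "\<dots> \<doteq> (P' * P') * (T * P * P) * (P' * P')"
      by (rule cong_mid[OF P_T])
    also have "\<dots> \<doteq> P' * P' * T"
      using cong_left[OF PP(1), of "P' * P' * T"] by (simp add: mult.assoc)
    finally show ?thesis .
  qed
  have gen: "Opposite x \<in> op.subring_gen (Opposite ` S)" if "x \<in> subring_gen S" for x S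
    using that
  proof induction
    case (diff x y)
    then show ?case
      using op.subring_gen.diff[OF diff.IH] by (simp add: opposite_defs)
  next
    case (mult x y)
    then show ?case
      using op.subring_gen.mult[OF mult.IH(2,1)] by (simp add: opposite_defs)
  next
    case one
    then show ?case
      using op.subring_gen.one by (simp add: opposite_defs)
  qed (auto intro: op.subring_gen.intros)
  interpret op: daha_presentation "Opposite ` J" "Opposite ` K" "Opposite q" "Opposite q'" "Opposite \<gamma>"
    "Opposite T" "Opposite X1" "Opposite X1'" "Opposite X2" "Opposite X2'" "Opposite P'" "Opposite P"
  proof
    show "additive_set (Opposite ` K)" "1 \<in> Opposite ` K"
      using scalars by (auto simp: additive_set_Opposite one_opposite_def)
    show "k * l \<in> Opposite ` K" if "k \<in> Opposite ` K" "l \<in> Opposite ` K" for k l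
      using that scalars(3) by (auto simp: times_opposite_def)
    show "\<exists>k'\<in>Opposite ` K. k' * k = 1" if "k \<in> Opposite ` K" "k \<noteq> 0" for k
      using that scalar_inverse central by (fastforce simp: opposite_defs)
    show "k * x = x * k" if "k \<in> Opposite ` K" for k x
      using central by (metis that times_opposite_def imageE opposite.sel)
    show "Opposite q * Opposite q' = 1"
      using q'_q by (simp add: opposite_defs)
    show "Opposite q \<in> Opposite ` K" "Opposite q' \<in> Opposite ` K" "Opposite \<gamma> \<in> Opposite ` K"
      using parameters by auto
    show "op.cong (Opposite X1 * Opposite X1') 1" "op.cong (Opposite X1' * Opposite X1) 1"
      "op.cong (Opposite X2 * Opposite X2') 1" "op.cong (Opposite X2' * Opposite X2) 1"
      "op.cong (Opposite P * Opposite P') 1" "op.cong (Opposite P' * Opposite P) 1"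
      using X1_inv X2_inv P_inv by (auto simp: times_opposite_def one_opposite_def cong)
    show "op.cong (Opposite X1 * Opposite X2) (Opposite X2 * Opposite X1)"
      using cong_sym[OF X_commute] by (simp add: times_opposite_def cong)
    show "op.cong (Opposite T * Opposite T) (Opposite \<gamma> * Opposite T + 1)"
      using quadratic central[OF parameters(4), of T]
      by (simp add: times_opposite_def plus_opposite_def one_opposite_def cong)
    show "op.cong (Opposite T * Opposite X1 * Opposite T) (Opposite X2)"
      using braid by (simp add: times_opposite_def cong mult.assoc)
    show "op.cong (Opposite P * Opposite X1 * Opposite P') (Opposite X2)"
      using P_X1 by (simp add: times_opposite_def cong mult.assoc)
    show "op.cong (Opposite P * Opposite X2 * Opposite P') (Opposite q' * Opposite X1)"
      using P_X2 central[OF parameters(2), of X1] by (simp add: times_opposite_def cong mult.assoc)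
    show "op.cong (Opposite P' * Opposite P' * Opposite T) (Opposite T * Opposite P' * Opposite P')"
      using P'_P'_T by (simp add: times_opposite_def cong mult.assoc)
    have "x \<in> op.subring_gen (Opposite ` (K \<union> {X1, X1', X2, X2', T, P, P'}))" for x
    proof -
      have "unopposite x \<in> subring_gen (K \<union> {X1, X1', X2, X2', T, P, P'})"
        unfolding generated by (rule UNIV_I)
      from gen[OF this] show ?thesis by simp
    qed
    then show "op.subring_gen (Opposite ` K \<union> {Opposite X1, Opposite X1', Opposite X2, Opposite X2',
        Opposite T, Opposite P', Opposite P}) = UNIV"
      by (auto simp: image_Un insert_commute)
  qed
  show ?thesis
    by (rule op.left_noetherian)
qed

end

section \<open>The relations of the double affine Hecke algebra\<close>

lemma free_algebra_induct [case_names single add]: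
  fixes x :: "'b \<Rightarrow>\<^sub>0 'c::comm_monoid_add"
  assumes single: "\<And>w c. Q (Poly_Mapping.single w c)" and add: "\<And>x y. Q x \<Longrightarrow> Q y \<Longrightarrow> Q (x + y)"
  shows "Q x"
proof (induction x rule: update_induct)
  case const
  then show ?case
    using single[of undefined 0] by simp
next
  case (update f a b)
  have "Poly_Mapping.update a b f = f + Poly_Mapping.single a b"
    by (rule poly_mapping_eqI)
       (use update in \<open>auto simp: lookup_update lookup_add lookup_single in_keys_iff when_def\<close>)
  then show ?case
    using add update single by simp
qed

lemma scalar_simps:
  "scalar 0 = 0" "scalar 1 = 1" "scalar c + scalar d = scalar (c + d)"
  "scalar c - scalar d = scalar (c - d)" "scalar c * scalar d = scalar (c * d)"
  by (simp_all add: scalar_def mult_single flip: single_add single_diff single_one)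

lemma scalar_central: "scalar c * x = x * scalar (c :: 'k::field)"
proof (induction x rule: free_algebra_induct)
  case (single w d)
  then show ?case
    by (simp add: scalar_def mult_single mult.commute)
qed (simp add: algebra_simps)

lemma free_algebra_generated:
  fixes J :: "('g, 'k::field) free_algebra set"
  assumes "two_sided_ideal J"
    and scalar: "\<And>c. scalar c \<in> two_sided_ideal.subring_gen J S"
    and letter: "\<And>g. letter g \<in> two_sided_ideal.subring_gen J S"
  shows "two_sided_ideal.subring_gen J S = UNIV"
proof -
  interpret two_sided_ideal J by fact
  have word: "Poly_Mapping.single (Word ws) c \<in> subring_gen S" for ws c
  proof (induction ws)
    case Nil
    then show ?case
      using scalar[of c] by (simp add: scalar_def zero_free_monoid_def)
  next
    case (Cons w ws)
    have "Poly_Mapping.single (Word (w # ws)) c = letter w * Poly_Mapping.single (Word ws) c"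
      by (simp add: letter_def mult_single plus_free_monoid_def)
    then show ?case
      using subring_gen.mult[OF letter Cons] by simp
  qed
  have "x \<in> subring_gen S" for x
  proof (induction x rule: free_algebra_induct)
    case (single w c)
    then show ?case
      using word[of "letters w" c] by simp
  qed (rule subring_gen_add)
  then show ?thesis by blast
qed

text \<open>
  The two ways of writing \<open>P\<close>, as \<open>Y\<^sub>2 T\<close> and as \<open>T\<^sup>-\<^sup>1 Y\<^sub>1\<close>, carry the computation. The first turns the relation
  between \<open>X\<^sub>1\<close>, \<open>Y\<^sub>2\<close> and \<open>T\<^sup>2\<close> into \<open>P\<^sup>-\<^sup>1 X\<^sub>1 P = T X\<^sub>1 T = X\<^sub>2\<close>. Their product is
  \<open>P\<^sup>2 = Y\<^sub>2 Y\<^sub>1\<close>, which \<open>q\<close>-commutes with \<open>X\<^sub>1\<close> and so yields \<open>P\<^sup>-\<^sup>1 X\<^sub>2 P = P\<^sup>-\<^sup>2 X\<^sub>1 P\<^sup>2 = q\<^sup>-\<^sup>1 X\<^sub>1\<close>.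
  No \<open>Y\<close> is lost: \<open>Y\<^sub>1 = T P\<close> and \<open>Y\<^sub>2 = P T\<^sup>-\<^sup>1\<close>.
\<close>

lemma daha_presentation_free_algebra:
  fixes q s :: "'k::field" and J :: "(daha_letter, 'k) free_algebra set"
  assumes J: "two_sided_ideal J" and rel: "daha_relations q s \<subseteq> J"
    and "q \<noteq> 0" "s \<noteq> 0"
  shows "daha_presentation J (range scalar) (scalar q) (scalar (inverse q)) (scalar (s - inverse s))
    (letter (Pos Gen_T)) (letter (Pos Gen_X1)) (letter (Neg Gen_X1))
    (letter (Pos Gen_X2)) (letter (Neg Gen_X2))
    (letter (Pos Gen_Y2) * letter (Pos Gen_T)) (letter (Neg Gen_T) * letter (Neg Gen_Y2))"
proof -
  interpret two_sided_ideal J by fact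
  define T T' X1 X1' X2 X2' Y1 Y1' Y2 Y2' :: "(daha_letter, 'k) free_algebra"
    where defs: "T = letter (Pos Gen_T)" "T' = letter (Neg Gen_T)"
      "X1 = letter (Pos Gen_X1)" "X1' = letter (Neg Gen_X1)"
      "X2 = letter (Pos Gen_X2)" "X2' = letter (Neg Gen_X2)"
      "Y1 = letter (Pos Gen_Y1)" "Y1' = letter (Neg Gen_Y1)"
      "Y2 = letter (Pos Gen_Y2)" "Y2' = letter (Neg Gen_Y2)"
  define k :: "'k \<Rightarrow> (daha_letter, 'k) free_algebra" where "k = scalar"
  have k_simps: "k 0 = 0" "k 1 = 1" "k c + k d = k (c + d)" "k c - k d = k (c - d)"
    "k c * k d = k (c * d)" for c d
    unfolding k_def by (rule scalar_simps)+
  have k_central: "k c * x = x * k c" for c x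
    unfolding k_def by (rule scalar_central)
  let ?\<gamma> = "k (s - inverse s)"
  have cong_rel: "x \<doteq> y" if "x - y \<in> daha_relations q s" for x y
    using that rel by (auto simp: cong_def)
  have inv: "T * T' \<doteq> 1" "T' * T \<doteq> 1" "X1 * X1' \<doteq> 1" "X1' * X1 \<doteq> 1" "X2 * X2' \<doteq> 1" "X2' * X2 \<doteq> 1"
    "Y1 * Y1' \<doteq> 1" "Y1' * Y1 \<doteq> 1" "Y2 * Y2' \<doteq> 1" "Y2' * Y2 \<doteq> 1"
    by (rule cong_rel; unfold daha_relations_def Let_def defs; blast)+
  have comm: "X1 * X2 \<doteq> X2 * X1" "Y1 * Y2 \<doteq> Y2 * Y1"
    and Hecke: "(T - k s) * (T + k (inverse s)) \<doteq> 0"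
    and cross: "Y2' * X1 * Y2 * X1' \<doteq> T\<^sup>2"
    and braid: "T' * Y1 * T' \<doteq> Y2" "T * X1 * T \<doteq> X2"
    and Y_X1: "Y1 * Y2 * X1 \<doteq> k q * X1 * Y1 * Y2"
    by (rule cong_rel; simp add: daha_relations_def Let_def defs k_def)+
  define P P' where "P = Y2 * T" and "P' = T' * Y2'"
  have P_inv: "P * P' \<doteq> 1" "P' * P \<doteq> 1"
  proof -
    have "P * P' \<doteq> Y2 * Y2'"
      using cong_mid[OF inv(1), of Y2 Y2'] by (simp add: P_def P'_def mult.assoc)
    also have "\<dots> \<doteq> 1" by (rule inv)
    finally show "P * P' \<doteq> 1" .
    have "P' * P \<doteq> T' * T"
      using cong_mid[OF inv(10), of T' T] by (simp add: P_def P'_def mult.assoc)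
    also have "\<dots> \<doteq> 1" by (rule inv)
    finally show "P' * P \<doteq> 1" .
  qed
  have quadratic: "T * T \<doteq> ?\<gamma> * T + 1"
  proof -
    have "(T - k s) * (T + k (inverse s)) = T * T - (?\<gamma> * T + 1)"
      using k_central[of "inverse s" T] k_simps(5)[of s "inverse s"] \<open>s \<noteq> 0\<close>
      by (simp add: algebra_simps k_simps(2) flip: k_simps(4))
    then show ?thesis
      using Hecke by (simp add: cong_def)
  qed
  (* the letter for the inverse of T is redundant *)
  have T': "T' \<doteq> T - ?\<gamma>"
  proof -
    have "T' * (T * T) \<doteq> T' * (?\<gamma> * T + 1)"
      by (rule cong_left[OF quadratic])
    also have "\<dots> = ?\<gamma> * (T' * T) + T'"
      using k_central[of _ T'] by (simp add: distrib_left flip: mult.assoc)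
    also have "\<dots> \<doteq> ?\<gamma> * 1 + T'"
      by (intro cong_add cong_left inv cong_refl)
    finally have "T' * (T * T) \<doteq> ?\<gamma> + T'" by simp
    moreover have "T' * (T * T) \<doteq> T"
      using cong_right[OF inv(2), of T] by (simp add: mult.assoc)
    ultimately have "T \<doteq> ?\<gamma> + T'"
      using cong_sym cong_trans by blast
    from cong_sym[OF this] show ?thesis
      by (simp add: cong_def algebra_simps)
  qed
  have P_Y1: "P \<doteq> T' * Y1"
  proof -
    have "P \<doteq> T' * Y1 * T' * T"
      using cong_right[OF cong_sym[OF braid(1)], of T] by (simp add: P_def)
    also have "\<dots> \<doteq> T' * Y1"
      using cong_left[OF inv(2), of "T' * Y1"] by (simp add: mult.assoc)
    finally show ?thesis .
  qed
  have Y1: "Y1 \<doteq> T * P"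
  proof -
    have "T * P \<doteq> T * T' * Y1"
      using cong_left[OF P_Y1, of T] by (simp add: mult.assoc)
    also have "\<dots> \<doteq> Y1"
      using cong_right[OF inv(1), of Y1] by simp
    finally show ?thesis by (rule cong_sym)
  qed
  have Y1': "Y1' \<doteq> P' * T'"
  proof -
    have "Y1' \<doteq> Y1' * T * T'"
      using cong_sym[OF cong_left[OF inv(1), of Y1']] by (simp add: mult.assoc)
    also have "\<dots> \<doteq> Y1' * T * P * P' * T'"
      using cong_sym[OF cong_mid[OF P_inv(1), of "Y1' * T" T']] by (simp add: mult.assoc)
    also have "\<dots> \<doteq> Y1' * Y1 * P' * T'"
      using cong_sym[OF cong_mid[OF Y1, of "Y1'" "P' * T'"]] by (simp add: mult.assoc)
    also have "\<dots> \<doteq> P' * T'"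
      using cong_right[OF inv(8), of "P' * T'"] by (simp add: mult.assoc)
    finally show ?thesis .
  qed
  have Y2: "Y2 \<doteq> P * T'" "Y2' \<doteq> T * P'"
    using cong_sym[OF cong_left[OF inv(1), of Y2]] cong_sym[OF cong_right[OF inv(1), of Y2']]
    by (simp_all add: P_def P'_def mult.assoc)
  have PP: "P * P \<doteq> Y2 * Y1"
  proof -
    have "P * P \<doteq> P * (T' * Y1)"
      by (rule cong_left[OF P_Y1])
    also have "\<dots> \<doteq> Y2 * Y1"
      using cong_mid[OF inv(1), of Y2 Y1] by (simp add: P_def mult.assoc)
    finally show ?thesis .
  qed
  have P_T: "P * P * T \<doteq> T * P * P"
  proof -
    have "P * P * T \<doteq> Y2 * Y1 * T"
      by (rule cong_right[OF PP])
    also have "\<dots> \<doteq> Y1 * Y2 * T"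
      by (rule cong_right[OF cong_sym[OF comm(2)]])
    also have "\<dots> \<doteq> T * P * P"
      using cong_right[OF Y1, of P] by (simp add: P_def mult.assoc)
    finally show ?thesis .
  qed
  have P_X1: "P' * X1 * P \<doteq> X2"
  proof -
    have "Y2' * X1 * Y2 \<doteq> Y2' * X1 * Y2 * X1' * X1"
      using cong_sym[OF cong_left[OF inv(4), of "Y2' * X1 * Y2"]] by (simp add: mult.assoc)
    also have "\<dots> \<doteq> T\<^sup>2 * X1"
      by (rule cong_right[OF cross])
    finally have "Y2' * X1 * Y2 \<doteq> T\<^sup>2 * X1" .
    from cong_mid[OF this, of T' T] have "P' * X1 * P \<doteq> T' * T * T * X1 * T"
      by (simp add: P_def P'_def power2_eq_square mult.assoc)
    also have "\<dots> \<doteq> T * X1 * T"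
      using cong_right[OF inv(2), of "T * X1 * T"] by (simp add: mult.assoc)
    also have "\<dots> \<doteq> X2" by (rule braid)
    finally show ?thesis .
  qed
  have P_X2: "P' * X2 * P \<doteq> k (inverse q) * X1"
  proof -
    have PP': "P * P \<doteq> Y1 * Y2"
      using cong_trans[OF PP cong_sym[OF comm(2)]] .
    have "P * P * X1 \<doteq> k q * X1 * Y1 * Y2"
      using cong_trans[OF cong_right[OF PP'] Y_X1] .
    also have "\<dots> \<doteq> k q * X1 * (P * P)"
      using cong_left[OF cong_sym[OF PP'], of "k q * X1"] by (simp add: mult.assoc)
    finally have "k (inverse q) * (P * P * X1) \<doteq> k (inverse q) * (k q * X1 * (P * P))"
      by (rule cong_left)
    also have "\<dots> = (k (inverse q) * k q) * (X1 * (P * P))"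
      by (simp only: mult.assoc)
    also have "\<dots> = X1 * (P * P)"
      using \<open>q \<noteq> 0\<close> by (simp add: k_simps)
    finally have XPP: "X1 * (P * P) \<doteq> k (inverse q) * (P * P * X1)"
      by (rule cong_sym)
    have "P' * X2 * P \<doteq> P' * (P' * X1 * P) * P"
      by (rule cong_mid[OF cong_sym[OF P_X1]])
    also have "\<dots> = P' * P' * (X1 * (P * P))"
      by (simp only: mult.assoc)
    also have "\<dots> \<doteq> P' * P' * (k (inverse q) * (P * P * X1))"
      by (rule cong_left[OF XPP])
    also have "\<dots> = k (inverse q) * (P' * P' * P * P * X1)"
      using k_central[of "inverse q" "P' * P'"] by (simp flip: mult.assoc)
    also have "\<dots> \<doteq> k (inverse q) * (P' * P * X1)"
      using cong_mid[OF P_inv(2), of "k (inverse q) * P'" "P * X1"] by (simp add: mult.assoc)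
    also have "\<dots> \<doteq> k (inverse q) * X1"
      using cong_mid[OF P_inv(2), of "k (inverse q)" "X1"] by (simp add: mult.assoc)
    finally show ?thesis .
  qed
  have generated: "subring_gen (range k \<union> {X1, X1', X2, X2', T, P, P'}) = UNIV" (is "?G = UNIV")
  proof (rule free_algebra_generated[OF J])
    note gen = subring_gen.generator[where S = "range k \<union> {X1, X1', X2, X2', T, P, P'}"]
    show "scalar c \<in> ?G" for c
      by (rule gen) (simp add: k_def)
    have PT: "P \<in> ?G" "P' \<in> ?G" "T \<in> ?G" "?\<gamma> \<in> ?G"
      by (rule gen; simp)+
    have T'_in: "T' \<in> ?G"
      by (rule subring_gen_cong[OF T']) (intro subring_gen.diff PT)
    show "letter g \<in> ?G" for g
    proof (cases g)
      case (Pos a)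
      then show ?thesis
        using subring_gen_cong[OF Y1 subring_gen.mult[OF PT(3,1)]]
          subring_gen_cong[OF Y2(1) subring_gen.mult[OF PT(1) T'_in]] gen
        by (cases a) (auto simp: defs)
    next
      case (Neg a)
      then show ?thesis
        using subring_gen_cong[OF Y1' subring_gen.mult[OF PT(2) T'_in]]
          subring_gen_cong[OF Y2(2) subring_gen.mult[OF PT(3,2)]] T'_in gen
        by (cases a) (auto simp: defs)
    qed
  qed
  have "daha_presentation J (range k) (k q) (k (inverse q)) ?\<gamma> T X1 X1' X2 X2' P P'"
  proof
    have k0: "0 = k 0" and k1: "1 = k 1"
      by (simp_all add: k_simps)
    have "0 \<in> range k"
      unfolding k0 by (rule rangeI)
    then show "additive_set (range k)"
      by (auto simp: additive_set_def k_simps)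
    show "1 \<in> range k"
      unfolding k1 by blast
    show "c * d \<in> range k" if "c \<in> range k" "d \<in> range k" for c d
      using that by (auto simp: k_simps)
    show "\<exists>c'\<in>range k. c' * c = 1" if "c \<in> range k" "c \<noteq> 0" for c
    proof -
      have "c \<noteq> k 0"
        using that(2) by (simp add: k_simps)
      then obtain d where d: "c = k d" "d \<noteq> 0"
        using \<open>c \<in> range k\<close> by blast
      then have "k (inverse d) * c = 1"
        by (simp add: k_simps)
      then show ?thesis by blast
    qed
    show "k q * k (inverse q) = 1"
      using \<open>q \<noteq> 0\<close> by (simp add: k_simps)
    show "c * x = x * c" if "c \<in> range k" for c x
      using that k_central by blast
  qed (use inv P_inv comm quadratic braid P_X1 P_X2 P_T generated in auto)
  then show ?thesis
    by (simp add: defs P_def P'_def k_def)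
qed

section \<open>One-sided ideals of a quotient ring\<close>

lemma ring_of_type_algebra_simps:
  "carrier ring_of_type_algebra = UNIV" "\<zero>\<^bsub>ring_of_type_algebra\<^esub> = 0" "\<one>\<^bsub>ring_of_type_algebra\<^esub> = 1"
  "x \<oplus>\<^bsub>ring_of_type_algebra\<^esub> y = x + y" "x \<otimes>\<^bsub>ring_of_type_algebra\<^esub> y = x * y"
  by (simp_all add: ring_of_type_algebra_def)

locale type_ring_ideal = ideal J "ring_of_type_algebra :: 'a::ring_1 ring" for J
begin

abbreviation R :: "'a ring" where "R \<equiv> ring_of_type_algebra"
abbreviation Q :: "'a set ring" where "Q \<equiv> R Quot J"
abbreviation coset :: "'a \<Rightarrow> 'a set" where "coset x \<equiv> J +>\<^bsub>R\<^esub> x"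

lemma two_sided_ideal_type: "two_sided_ideal J"
proof
  have uminus: "- x \<in> J" if "x \<in> J" for x
    using I_l_closed[OF that, of "- 1"] by (simp add: ring_of_type_algebra_simps)
  have add: "x + y \<in> J" if "x \<in> J" "y \<in> J" for x y
    using additive_subgroup.a_closed[OF is_additive_subgroup that] by (simp add: ring_of_type_algebra_simps)
  show "additive_set J"
    using additive_subgroup.zero_closed[OF is_additive_subgroup] add uminus unfolding additive_set_def
    by (metis ring_of_type_algebra_simps(2) add_uminus_conv_diff)
  show "y * x \<in> J" "x * y \<in> J" if "x \<in> J" for x y
    using I_l_closed[OF that, of y] I_r_closed[OF that, of y] by (simp_all add: ring_of_type_algebra_simps)
qed

lemma coset_simps:
  "coset x \<oplus>\<^bsub>Q\<^esub> coset y = coset (x + y)" "coset x \<otimes>\<^bsub>Q\<^esub> coset y = coset (x * y)"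
  "coset x \<in> carrier Q" "coset 0 = \<zero>\<^bsub>Q\<^esub>"
proof -
  interpret h: ring_hom_ring R Q "(+>\<^bsub>R\<^esub>) J"
    by (rule rcos_ring_hom_ring)
  show "coset x \<oplus>\<^bsub>Q\<^esub> coset y = coset (x + y)" "coset x \<otimes>\<^bsub>Q\<^esub> coset y = coset (x * y)"
    "coset x \<in> carrier Q" "coset 0 = \<zero>\<^bsub>Q\<^esub>"
    using h.hom_add[of x y] h.hom_mult[of x y] h.hom_closed[of x] h.hom_zero
    by (simp_all add: ring_of_type_algebra_simps)
qed

lemma coset_surj: "C \<in> carrier Q \<Longrightarrow> \<exists>x. C = coset x"
  by (auto simp: FactRing_def A_RCOSETS_def' ring_of_type_algebra_simps)

lemma coset_ideal: "x \<in> J \<Longrightarrow> coset x = \<zero>\<^bsub>Q\<^esub>"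
  using a_rcos_zero[OF is_ideal] by (simp add: FactRing_def)

lemma preimage_additive:
  assumes "additive_subgroup I Q" "\<And>x. coset x \<in> I \<Longrightarrow> coset (- x) \<in> I"
  shows "additive_set {x. coset x \<in> I}" "J \<subseteq> {x. coset x \<in> I}"
proof -
  interpret I: additive_subgroup I Q by fact
  have "coset (x - y) \<in> I" if "coset x \<in> I" "coset y \<in> I" for x y
    using I.a_closed[OF that(1) assms(2)[OF that(2)]] by (simp add: coset_simps)
  then show "additive_set {x. coset x \<in> I}"
    unfolding additive_set_def using I.zero_closed by (simp add: coset_simps)
  show "J \<subseteq> {x. coset x \<in> I}"
    using coset_ideal I.zero_closed by auto
qed

lemma preimage_left_ideal:
  assumes "left_ideal I Q"
  shows "left_submodule UNIV {x. coset x \<in> I}" "J \<subseteq> {x. coset x \<in> I}"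
proof -
  interpret I: left_ideal I Q by fact
  have mult: "coset (y * x) \<in> I" if "coset x \<in> I" for x y
    using I.l_closed[OF that, of "coset y"] by (simp add: coset_simps)
  have "coset (- x) \<in> I" if "coset x \<in> I" for x
    using mult[OF that, of "- 1"] by simp
  note * = preimage_additive[OF I.additive_subgroup_axioms this]
  show "left_submodule UNIV {x. coset x \<in> I}" "J \<subseteq> {x. coset x \<in> I}"
    using * mult unfolding left_submodule_def by auto
qed

lemma preimage_right_ideal:
  assumes "right_ideal I Q"
  shows "left_submodule UNIV (Opposite ` {x. coset x \<in> I})" "J \<subseteq> {x. coset x \<in> I}"
proof -
  interpret I: right_ideal I Q by fact
  have mult: "coset (x * y) \<in> I" if "coset x \<in> I" for x y
    using I.r_closed[OF that, of "coset y"] by (simp add: coset_simps)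
  have "coset (- x) \<in> I" if "coset x \<in> I" for x
    using mult[OF that, of "- 1"] by simp
  note * = preimage_additive[OF I.additive_subgroup_axioms this]
  show "left_submodule UNIV (Opposite ` {x. coset x \<in> I})" "J \<subseteq> {x. coset x \<in> I}"
    using * mult unfolding left_submodule_def by (auto simp: additive_set_Opposite times_opposite_def)
qed

text \<open>
  Generators of the preimage of an ideal map to generators of the ideal, because the preimages of
  ideals reflect inclusions.
\<close>

lemma quotient_left_noetherian:
  assumes "left_acc J UNIV"
  shows "left_noetherian_ring Q"
proof -
  have "\<exists>A\<subseteq>carrier Q. finite A \<and> I = gen_left_ideal Q A" if I: "left_ideal I Q" for I
  proof -
    interpret I: left_ideal I Q by fact
    obtain S where S: "finite S" "S \<subseteq> {x. coset x \<in> I}"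
      "\<And>M. left_submodule UNIV M \<Longrightarrow> J \<subseteq> M \<Longrightarrow> S \<subseteq> M \<Longrightarrow> {x. coset x \<in> I} \<subseteq> M"
      using left_acc_finitely_generated[OF assms preimage_left_ideal[OF I]] by metis
    have "I \<subseteq> I'" if I': "left_ideal I' Q" "coset ` S \<subseteq> I'" for I'
    proof
      fix C assume "C \<in> I"
      then obtain x where "C = coset x" "coset x \<in> I"
        using coset_surj I.a_subset by blast
      moreover have "{x. coset x \<in> I} \<subseteq> {x. coset x \<in> I'}"
        by (rule S(3)) (use preimage_left_ideal[OF I'(1)] I'(2) in auto)
      ultimately show "C \<in> I'" by blast
    qed
    then have "I = gen_left_ideal Q (coset ` S)"
      unfolding gen_left_ideal_def using S(2) I by blast
    moreover have "coset ` S \<subseteq> carrier Q"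
      by (auto simp: coset_simps)
    ultimately show ?thesis
      using S(1) by (intro exI[of _ "coset ` S"]) auto
  qed
  then show ?thesis
    by (intro left_noetherian_ring.intro left_noetherian_ring_axioms.intro quotient_is_ring)
qed

lemma quotient_right_noetherian:
  assumes "left_acc (Opposite ` J) UNIV"
  shows "right_noetherian_ring Q"
proof -
  have "\<exists>A\<subseteq>carrier Q. finite A \<and> I = gen_right_ideal Q A" if I: "right_ideal I Q" for I
  proof -
    interpret I: right_ideal I Q by fact
    obtain S where S: "finite S" "S \<subseteq> Opposite ` {x. coset x \<in> I}"
      "\<And>M. left_submodule UNIV M \<Longrightarrow> Opposite ` J \<subseteq> M \<Longrightarrow> S \<subseteq> M \<Longrightarrow> Opposite ` {x. coset x \<in> I} \<subseteq> M"
      using left_acc_finitely_generated[OF assms preimage_right_ideal(1)[OF I]]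
        image_mono[OF preimage_right_ideal(2)[OF I]] by metis
    define A where "A = (\<lambda>x. coset (unopposite x)) ` S"
    have "I \<subseteq> I'" if I': "right_ideal I' Q" "A \<subseteq> I'" for I'
    proof
      fix C assume "C \<in> I"
      then obtain x where "C = coset x" "coset x \<in> I"
        using coset_surj I.a_subset by blast
      moreover have "Opposite ` {x. coset x \<in> I} \<subseteq> Opposite ` {x. coset x \<in> I'}"
      proof (rule S(3))
        show "left_submodule UNIV (Opposite ` {x. coset x \<in> I'})"
          by (rule preimage_right_ideal[OF I'(1)])
        show "Opposite ` J \<subseteq> Opposite ` {x. coset x \<in> I'}"
          by (rule image_mono[OF preimage_right_ideal(2)[OF I'(1)]])
        show "S \<subseteq> Opposite ` {x. coset x \<in> I'}"
        proof
          fix y assume "y \<in> S"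
          then have "coset (unopposite y) \<in> I'"
            using I'(2) by (auto simp: A_def)
          then show "y \<in> Opposite ` {x. coset x \<in> I'}"
            by (intro image_eqI[of _ _ "unopposite y"]) auto
        qed
      qed
      ultimately show "C \<in> I'" by blast
    qed
    moreover have "A \<subseteq> I"
      using S(2) by (auto simp: A_def)
    ultimately have "I = gen_right_ideal Q A"
      unfolding gen_right_ideal_def using I by blast
    moreover have "A \<subseteq> carrier Q"
      by (auto simp: coset_simps A_def)
    ultimately show ?thesis
      using S(1) by (intro exI[of _ A]) (auto simp: A_def)
  qed
  then show ?thesis
    by (intro right_noetherian_ring.intro right_noetherian_ring_axioms.intro quotient_is_ring)
qed

end

theorem theorem3p2:
  fixes q t s :: "'k::field"
  assumes "CHAR('k) \<noteq> 2"
    and "q \<noteq> 0" and "t \<noteq> 0"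
    and "s^2 = t"
  shows "left_right_noetherian_ring (daha_GL2 q s)"
proof -
  let ?R = "ring_of_type_algebra :: (daha_letter, 'k) free_algebra ring"
  define J where "J = genideal ?R (daha_relations q s)"
  interpret F: ring ?R
    by (rule ring_of_type_algebra_is_ring)
  interpret type_ring_ideal J
    unfolding type_ring_ideal_def J_def by (rule F.genideal_ideal) (simp add: ring_of_type_algebra_simps)
  have "daha_relations q s \<subseteq> J"
    unfolding J_def by (rule F.genideal_self) (simp add: ring_of_type_algebra_simps)
  moreover have "s \<noteq> 0"
    using assms by auto
  ultimately interpret daha_presentation J "range scalar" "scalar q" "scalar (inverse q)"
    "scalar (s - inverse s)" "letter (Pos Gen_T)" "letter (Pos Gen_X1)" "letter (Neg Gen_X1)"
    "letter (Pos Gen_X2)" "letter (Neg Gen_X2)"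
    "letter (Pos Gen_Y2) * letter (Pos Gen_T)" "letter (Neg Gen_T) * letter (Neg Gen_Y2)"
    using daha_presentation_free_algebra[OF two_sided_ideal_type] assms(2) by blast
  have "daha_GL2 q s = Q"
    by (simp add: daha_GL2_def J_def)
  then show ?thesis
    unfolding left_right_noetherian_ring_def
    using quotient_left_noetherian[OF left_noetherian] quotient_right_noetherian[OF right_noetherian]
    by simp
qed

end
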